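(* Let $X$ be an affine algebraic variety isomorphic to $\mathrm{SL}(n,\mathbb{C})$ with $n\ge 3$. Then there exist two closed subvarieties $Y_1,Y_2\subset X$, both isomorphic to $\mathrm{SL}(2,\mathbb{C})$, such that there is no automorphism $\alpha$ of $X$ with $\alpha(Y_1)=Y_2$. *)

theory Defs
  imports Complex_Main "Jordan_Normal_Form.Determinant"
begin

text \<open>Points of affine space are functions nat \<Rightarrow> complex; an affine variety lives
in some C^N, i.e. all coordinates with index \<ge> N vanish.
Polynomial (regular) functions: generated by constants and coordinates under + and *.\<close>

inductive_set poly_fun :: "((nat \<Rightarrow> complex) \<Rightarrow> complex) set" where
  const: "(\<lambda>x. c) \<in> poly_fun"
| var: "(\<lambda>x. x i) \<in> poly_fun"
| add: "p \<in> poly_fun \<Longrightarrow> q \<in> poly_fun \<Longrightarrow> (\<lambda>x. p x + q x) \<in> poly_fun"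
| mult: "p \<in> poly_fun \<Longrightarrow> q \<in> poly_fun \<Longrightarrow> (\<lambda>x. p x * q x) \<in> poly_fun"

definition affine_variety :: "(nat \<Rightarrow> complex) set \<Rightarrow> bool" where
  "affine_variety X \<longleftrightarrow> (\<exists>N F. F \<subseteq> poly_fun \<and>
      X = {x. (\<forall>i\<ge>N. x i = 0) \<and> (\<forall>f\<in>F. f x = 0)})"

definition morphism :: "(nat \<Rightarrow> complex) set \<Rightarrow> (nat \<Rightarrow> complex) set
    \<Rightarrow> ((nat \<Rightarrow> complex) \<Rightarrow> (nat \<Rightarrow> complex)) \<Rightarrow> bool" where
  "morphism X Y \<phi> \<longleftrightarrow> (\<forall>i. \<exists>p\<in>poly_fun. \<forall>x\<in>X. \<phi> x i = p x) \<and> \<phi> ` X \<subseteq> Y"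

definition iso_morphism :: "(nat \<Rightarrow> complex) set \<Rightarrow> (nat \<Rightarrow> complex) set
    \<Rightarrow> ((nat \<Rightarrow> complex) \<Rightarrow> (nat \<Rightarrow> complex)) \<Rightarrow> bool" where
  "iso_morphism X Y \<phi> \<longleftrightarrow> (\<exists>\<psi>. morphism X Y \<phi> \<and> morphism Y X \<psi> \<and>
      (\<forall>x\<in>X. \<psi> (\<phi> x) = x) \<and> (\<forall>y\<in>Y. \<phi> (\<psi> y) = y))"

definition isomorphic :: "(nat \<Rightarrow> complex) set \<Rightarrow> (nat \<Rightarrow> complex) set \<Rightarrow> bool" where
  "isomorphic X Y \<longleftrightarrow> (\<exists>\<phi>. iso_morphism X Y \<phi>)"

definition automorphism :: "(nat \<Rightarrow> complex) set \<Rightarrow> ((nat \<Rightarrow> complex) \<Rightarrow> (nat \<Rightarrow> complex)) \<Rightarrow> bool" where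
  "automorphism X \<alpha> \<longleftrightarrow> iso_morphism X X \<alpha>"

definition closed_subvariety :: "(nat \<Rightarrow> complex) set \<Rightarrow> (nat \<Rightarrow> complex) set \<Rightarrow> bool" where
  "closed_subvariety Y X \<longleftrightarrow> Y \<subseteq> X \<and> affine_variety Y"

definition SL_var :: "nat \<Rightarrow> (nat \<Rightarrow> complex) set" where
  "SL_var n = {x. (\<forall>k\<ge>n*n. x k = 0) \<and> det (mat n n (\<lambda>(i,j). x (i*n+j))) = 1}"

end

theory Submission
  imports Defs "HOL-Analysis.Henstock_Kurzweil_Integration" "HOL-Library.Function_Algebras"
begin

text \<open>
  Let \<open>Y1\<close> be the standard block copy of SL(2) in SL(n) and let \<open>Y2\<close> be a copy lying in a closed subvariety
  isomorphic to affine 4-space, which exists since \<open>n \<ge> 3\<close>. Scaling this affine space contracts the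
  inclusion of \<open>Y2\<close> to a point through polynomial maps, so an automorphism taking \<open>Y1\<close> to \<open>Y2\<close> would
  give a polynomial homotopy \<open>M\<close>, with values in SL(n), from the standard inclusion to a constant map.
  For such a homotopy consider the pullback of the 3-form tr((g^{-1} dg)^3), that is, the function
  \<open>phi = tr (a [b, c])\<close>, where \<open>a, b, c\<close> are the logarithmic derivatives of \<open>M\<close> along the left-invariant
  vector fields E, F, H of SL(2). By the Maurer--Cartan equations the derivative of \<open>phi\<close> in the homotopy
  parameter is a sum of derivatives along E, F, H, so its mean over SU(2) vanishes and the mean of \<open>phi\<close>
  is constant. But \<open>phi\<close> is 2 for the standard inclusion and 0 for a constant map.
\<close>

hide_const (open) Finite_Cartesian_Product.mat

section \<open>Polynomial functions and polynomial vector fields\<close>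

named_theorems poly_intros

lemmas [poly_intros] = poly_fun.const poly_fun.var poly_fun.add poly_fun.mult

lemma poly_fun_uminus [poly_intros]: "p \<in> poly_fun \<Longrightarrow> (\<lambda>x. - p x) \<in> poly_fun"
  using poly_fun.mult[OF poly_fun.const[of "-1"]] by simp

lemma poly_fun_diff [poly_intros]: "p \<in> poly_fun \<Longrightarrow> q \<in> poly_fun \<Longrightarrow> (\<lambda>x. p x - q x) \<in> poly_fun"
  using poly_fun.add[of p "\<lambda>x. - q x"] poly_fun_uminus[of q] by simp

lemma poly_fun_sum [poly_intros]:
  "(\<And>i. i \<in> A \<Longrightarrow> f i \<in> poly_fun) \<Longrightarrow> (\<lambda>x. \<Sum>i\<in>A. f i x) \<in> poly_fun"
  by (induction A rule: infinite_finite_induct) (auto intro: poly_intros)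

lemma poly_fun_prod [poly_intros]:
  "(\<And>i. i \<in> A \<Longrightarrow> f i \<in> poly_fun) \<Longrightarrow> (\<lambda>x. \<Prod>i\<in>A. f i x) \<in> poly_fun"
  by (induction A rule: infinite_finite_induct) (auto intro: poly_intros)

lemma poly_fun_power [poly_intros]: "p \<in> poly_fun \<Longrightarrow> (\<lambda>x. p x ^ k) \<in> poly_fun"
  by (induction k) (auto intro: poly_intros)

lemma poly_fun_if [poly_intros]:
  "(P \<Longrightarrow> p \<in> poly_fun) \<Longrightarrow> (\<not> P \<Longrightarrow> q \<in> poly_fun) \<Longrightarrow> (\<lambda>x. if P then p x else q x) \<in> poly_fun"
  by (cases P) auto

lemma poly_fun_compose:
  assumes "p \<in> poly_fun" "\<And>i. g i \<in> poly_fun"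
  shows "(\<lambda>x. p (\<lambda>i. g i x)) \<in> poly_fun"
  using assms(1) by induction (auto intro: poly_intros assms(2))

lemma poly_fun_det [poly_intros]:
  assumes "\<And>i j. i < n \<Longrightarrow> j < n \<Longrightarrow> f i j \<in> poly_fun"
  shows "(\<lambda>x. det (mat n n (\<lambda>(i, j). f i j x))) \<in> poly_fun"
proof -
  have "(\<lambda>x. \<Sum>p\<in>{p. p permutes {0..<n}}. signof p * (\<Prod>i = 0..<n. f i (p i) x)) \<in> poly_fun"
    by (intro poly_intros assms) (auto simp: permutes_in_image)
  moreover have "det (mat n n (\<lambda>(i, j). f i j x)) =
      (\<Sum>p\<in>{p. p permutes {0..<n}}. signof p * (\<Prod>i = 0..<n. f i (p i) x))" for x
    by (simp add: det_def)
  ultimately show ?thesis by simp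
qed

section \<open>Derivatives of polynomials along polynomial vector fields\<close>

definition lie :: "(nat \<Rightarrow> (nat \<Rightarrow> complex) \<Rightarrow> complex) \<Rightarrow> ((nat \<Rightarrow> complex) \<Rightarrow> complex)
    \<Rightarrow> (nat \<Rightarrow> complex) \<Rightarrow> complex" where
  "lie v p x = deriv (\<lambda>s. p (\<lambda>i. x i + s * v i x)) 0"

text \<open>A chain rule by induction on the generation of p. The value d is chosen before the
  curve, so it depends only on the point x and the velocity w; straight lines may therefore be
  exchanged for curves that stay inside a variety.\<close>

lemma poly_fun_differentiable:
  assumes "p \<in> poly_fun"
  shows "\<exists>d. \<forall>\<gamma>. \<gamma> 0 = x \<longrightarrow> (\<forall>i. ((\<lambda>s. \<gamma> s i) has_field_derivative w i) (at 0)) \<longrightarrow>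
    ((\<lambda>s. p (\<gamma> s)) has_field_derivative d) (at 0)"
  using assms
proof induction
  case (const c)
  show ?case by (intro exI[of _ 0]) auto
next
  case (var i)
  show ?case by (intro exI[of _ "w i"]) auto
next
  case (add p q)
  then obtain d e where
    "\<forall>\<gamma>. \<gamma> 0 = x \<longrightarrow> (\<forall>i. ((\<lambda>s. \<gamma> s i) has_field_derivative w i) (at 0)) \<longrightarrow>
      ((\<lambda>s. p (\<gamma> s)) has_field_derivative d) (at 0)"
    "\<forall>\<gamma>. \<gamma> 0 = x \<longrightarrow> (\<forall>i. ((\<lambda>s. \<gamma> s i) has_field_derivative w i) (at 0)) \<longrightarrow>
      ((\<lambda>s. q (\<gamma> s)) has_field_derivative e) (at 0)" by auto
  then show ?case by (intro exI[of _ "d + e"]) (auto intro!: DERIV_add)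
next
  case (mult p q)
  then obtain d e where
    d: "\<And>\<gamma>. \<gamma> 0 = x \<Longrightarrow> \<forall>i. ((\<lambda>s. \<gamma> s i) has_field_derivative w i) (at 0) \<Longrightarrow>
      ((\<lambda>s. p (\<gamma> s)) has_field_derivative d) (at 0)" and
    e: "\<And>\<gamma>. \<gamma> 0 = x \<Longrightarrow> \<forall>i. ((\<lambda>s. \<gamma> s i) has_field_derivative w i) (at 0) \<Longrightarrow>
      ((\<lambda>s. q (\<gamma> s)) has_field_derivative e) (at 0)" by blast
  show ?case
    by (intro exI[of _ "d * q x + e * p x"] allI impI DERIV_cong[OF DERIV_mult[OF d e]]) auto
qed

lemma lie_curve:
  assumes p: "p \<in> poly_fun" and "\<gamma> 0 = x"
    and "\<And>i. ((\<lambda>s. \<gamma> s i) has_field_derivative v i x) (at 0)"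
  shows "((\<lambda>s. p (\<gamma> s)) has_field_derivative lie v p x) (at 0)"
proof -
  obtain d where d: "\<And>\<gamma>. \<gamma> 0 = x \<Longrightarrow> (\<And>i. ((\<lambda>s. \<gamma> s i) has_field_derivative v i x) (at 0)) \<Longrightarrow>
      ((\<lambda>s. p (\<gamma> s)) has_field_derivative d) (at 0)"
    using poly_fun_differentiable[OF p, of x "\<lambda>i. v i x"] by metis
  have "((\<lambda>s. p (\<lambda>i. x i + s * v i x)) has_field_derivative d) (at 0)"
    by (rule d) (auto intro!: derivative_eq_intros)
  then have "lie v p x = d" unfolding lie_def by (rule DERIV_imp_deriv)
  then show ?thesis using d assms by auto
qed

lemma lie_line:
  "p \<in> poly_fun \<Longrightarrow> ((\<lambda>s. p (\<lambda>i. x i + s * v i x)) has_field_derivative lie v p x) (at 0)"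
  by (rule lie_curve) (auto intro!: derivative_eq_intros)

lemma lie_const [simp]: "lie v (\<lambda>x. c) = (\<lambda>x. 0)"
  by (simp add: lie_def fun_eq_iff)

lemma lie_var [simp]: "lie v (\<lambda>x. x i) = v i"
  unfolding lie_def by (intro ext DERIV_imp_deriv) (auto intro!: derivative_eq_intros)

lemma lie_add:
  assumes "p \<in> poly_fun" "q \<in> poly_fun"
  shows "lie v (\<lambda>x. p x + q x) = (\<lambda>x. lie v p x + lie v q x)"
  unfolding lie_def[of v "\<lambda>x. p x + q x"]
  by (intro ext DERIV_imp_deriv DERIV_add lie_line assms)

lemma lie_mult:
  assumes "p \<in> poly_fun" "q \<in> poly_fun"
  shows "lie v (\<lambda>x. p x * q x) = (\<lambda>x. lie v p x * q x + p x * lie v q x)"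
  unfolding lie_def[of v "\<lambda>x. p x * q x"]
  by (intro ext DERIV_imp_deriv DERIV_cong[OF DERIV_mult[OF lie_line lie_line]] assms) simp

lemma lie_uminus:
  assumes "p \<in> poly_fun"
  shows "lie v (\<lambda>x. - p x) = (\<lambda>x. - lie v p x)"
  unfolding lie_def[of v "\<lambda>x. - p x"]
  by (intro ext DERIV_imp_deriv DERIV_minus lie_line assms)

lemma lie_diff:
  assumes "p \<in> poly_fun" "q \<in> poly_fun"
  shows "lie v (\<lambda>x. p x - q x) = (\<lambda>x. lie v p x - lie v q x)"
  unfolding lie_def[of v "\<lambda>x. p x - q x"]
  by (intro ext DERIV_imp_deriv DERIV_diff lie_line assms)

lemma lie_sum:
  assumes "\<And>i. i \<in> A \<Longrightarrow> f i \<in> poly_fun"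
  shows "lie v (\<lambda>x. \<Sum>i\<in>A. f i x) = (\<lambda>x. \<Sum>i\<in>A. lie v (f i) x)"
  unfolding lie_def[of v "\<lambda>x. \<Sum>i\<in>A. f i x"]
  by (intro ext DERIV_imp_deriv DERIV_sum lie_line assms)

lemma lie_power:
  assumes "p \<in> poly_fun"
  shows "lie v (\<lambda>x. p x ^ k) = (\<lambda>x. of_nat k * p x ^ (k - 1) * lie v p x)"
  unfolding lie_def[of v "\<lambda>x. p x ^ k"]
  by (intro ext DERIV_imp_deriv DERIV_cong[OF DERIV_power[OF lie_line]] assms) simp

lemma poly_fun_lie [poly_intros]:
  assumes "p \<in> poly_fun" "\<And>i. v i \<in> poly_fun"
  shows "lie v p \<in> poly_fun"
  using assms(1) by induction (auto simp: lie_add lie_mult intro: poly_intros assms(2))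

text \<open>Both sides are derivations in p, since the mixed first-order terms of the product rule
  cancel on the left, and they agree on coordinates.\<close>

lemma lie_bracket:
  assumes "p \<in> poly_fun" "\<And>i. v i \<in> poly_fun" "\<And>i. w i \<in> poly_fun"
  shows "lie v (lie w p) x - lie w (lie v p) x = lie (\<lambda>i x. lie v (w i) x - lie w (v i) x) p x"
  using assms(1)
proof (induction arbitrary: x)
  case (add p q)
  then show ?case by (simp add: lie_add poly_fun_lie assms algebra_simps)
next
  case (mult p q)
  let ?u = "\<lambda>i x. lie v (w i) x - lie w (v i) x"
  have "lie v (lie w (\<lambda>x. p x * q x)) x - lie w (lie v (\<lambda>x. p x * q x)) x
     = (lie v (lie w p) x - lie w (lie v p) x) * q x + p x * (lie v (lie w q) x - lie w (lie v q) x)"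
    using mult.hyps
    by (simp add: lie_mult lie_add poly_fun_lie poly_fun.mult assms algebra_simps)
  then show ?case using mult by (simp add: lie_mult)
qed auto

text \<open>Tangency is expressed by curves inside S, so that two polynomials that agree on S have
  the same derivative along v there, without any argument about the ideal of S.\<close>

definition tangent :: "(nat \<Rightarrow> (nat \<Rightarrow> complex) \<Rightarrow> complex) \<Rightarrow> (nat \<Rightarrow> complex) set \<Rightarrow> bool" where
  "tangent v S \<longleftrightarrow> (\<forall>x\<in>S. \<exists>\<gamma>. \<gamma> 0 = x \<and> (\<forall>s. \<gamma> s \<in> S) \<and>
     (\<forall>i. ((\<lambda>s. \<gamma> s i) has_field_derivative v i x) (at 0)))"

lemma lie_cong_on:
  assumes "tangent v S" "x \<in> S" "p \<in> poly_fun" "q \<in> poly_fun" "\<And>y. y \<in> S \<Longrightarrow> p y = q y"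
  shows "lie v p x = lie v q x"
proof -
  obtain \<gamma> where \<gamma>: "\<gamma> 0 = x" "\<And>s. \<gamma> s \<in> S" "\<And>i. ((\<lambda>s. \<gamma> s i) has_field_derivative v i x) (at 0)"
    using assms(1,2) unfolding tangent_def by metis
  have "(\<lambda>s. p (\<gamma> s)) = (\<lambda>s. q (\<gamma> s))" using assms(5) \<gamma>(2) by auto
  then show ?thesis
    using lie_curve[where v = v, OF assms(3) \<gamma>(1,3)] lie_curve[where v = v, OF assms(4) \<gamma>(1,3)]
    by (metis DERIV_unique)
qed

section \<open>An invariant mean on the coordinate ring of SL(2)\<close>

text \<open>Coordinates 0, 1, 2, 3 are the entries of a 2 by 2 matrix in row-major order and coordinate 4 is
  a homotopy parameter. The fields E, F, H generate right multiplication by the one-parameter groups of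
  the standard basis of sl(2).\<close>

definition E_field :: "nat \<Rightarrow> (nat \<Rightarrow> complex) \<Rightarrow> complex" where
  "E_field i x = (if i = 1 then x 0 else if i = 3 then x 2 else 0)"

definition F_field :: "nat \<Rightarrow> (nat \<Rightarrow> complex) \<Rightarrow> complex" where
  "F_field i x = (if i = 0 then x 1 else if i = 2 then x 3 else 0)"

definition H_field :: "nat \<Rightarrow> (nat \<Rightarrow> complex) \<Rightarrow> complex" where
  "H_field i x = (if i = 0 then x 0 else if i = 1 then - x 1 else if i = 2 then x 2
     else if i = 3 then - x 3 else 0)"

definition T_field :: "nat \<Rightarrow> (nat \<Rightarrow> complex) \<Rightarrow> complex" where
  "T_field i x = (if i = 4 then 1 else 0)"

lemma poly_fun_fields [poly_intros]:
  "E_field i \<in> poly_fun" "F_field i \<in> poly_fun" "H_field i \<in> poly_fun" "T_field i \<in> poly_fun"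
  by (auto simp: E_field_def[abs_def] F_field_def[abs_def] H_field_def[abs_def] T_field_def[abs_def]
      intro!: poly_intros)

text \<open>\<open>cyl\<close> is the product of SL(2) with the affine line of the homotopy
  parameter, and \<open>slice t\<close> is its fibre over t.\<close>

definition slice :: "complex \<Rightarrow> (nat \<Rightarrow> complex) set" where
  "slice t = {x. x 0 * x 3 - x 1 * x 2 = 1 \<and> x 4 = t \<and> (\<forall>i\<ge>5. x i = 0)}"

definition cyl :: "(nat \<Rightarrow> complex) set" where
  "cyl = {x. x 0 * x 3 - x 1 * x 2 = 1 \<and> (\<forall>i\<ge>5. x i = 0)}"

lemma slice_subset_cyl: "x \<in> slice t \<Longrightarrow> x \<in> cyl"
  by (auto simp: slice_def cyl_def)

lemma cyl_in_slice: "x \<in> cyl \<Longrightarrow> x \<in> slice (x 4)"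
  by (auto simp: slice_def cyl_def)

lemma tangent_E: "tangent E_field (slice t)"
  unfolding tangent_def
proof
  fix x assume x: "x \<in> slice t"
  show "\<exists>\<gamma>. \<gamma> 0 = x \<and> (\<forall>s. \<gamma> s \<in> slice t) \<and>
     (\<forall>i. ((\<lambda>s. \<gamma> s i) has_field_derivative E_field i x) (at 0))"
    using x by (intro exI[of _ "\<lambda>s i. x i + s * E_field i x"])
      (auto simp: slice_def E_field_def algebra_simps intro!: derivative_eq_intros)
qed

lemma tangent_F: "tangent F_field (slice t)"
  unfolding tangent_def
proof
  fix x assume x: "x \<in> slice t"
  show "\<exists>\<gamma>. \<gamma> 0 = x \<and> (\<forall>s. \<gamma> s \<in> slice t) \<and>
     (\<forall>i. ((\<lambda>s. \<gamma> s i) has_field_derivative F_field i x) (at 0))"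
    using x by (intro exI[of _ "\<lambda>s i. x i + s * F_field i x"])
      (auto simp: slice_def F_field_def algebra_simps intro!: derivative_eq_intros)
qed

text \<open>The straight lines that serve for the nilpotent E and F leave the group here, because H
  is semisimple; the curve is right multiplication by diag(exp s, exp (-s)).\<close>

lemma tangent_H: "tangent H_field (slice t)"
  unfolding tangent_def
proof
  fix x assume x: "x \<in> slice t"
  have *: "exp s * exp (- s) = 1" for s :: complex
    by (simp add: exp_minus)
  let ?g = "\<lambda>s i. if i = 0 \<or> i = 2 then x i * exp s else if i = 1 \<or> i = 3 then x i * exp (- s) else x i"
  have "?g s \<in> slice t" for s
  proof -
    have "x 0 * exp s * (x 3 * exp (- s)) - x 1 * exp (- s) * (x 2 * exp s)
        = (x 0 * x 3 - x 1 * x 2) * (exp s * exp (- s))" by (simp add: right_diff_distrib mult_ac)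
    then show ?thesis using x unfolding * by (simp add: slice_def)
  qed
  moreover have "((\<lambda>s. ?g s i) has_field_derivative H_field i x) (at 0)" for i
    by (auto simp: H_field_def intro!: derivative_eq_intros)
  ultimately show "\<exists>\<gamma>. \<gamma> 0 = x \<and> (\<forall>s. \<gamma> s \<in> slice t) \<and>
     (\<forall>i. ((\<lambda>s. \<gamma> s i) has_field_derivative H_field i x) (at 0))"
    by (intro exI[of _ ?g]) auto
qed

lemma tangent_T: "tangent T_field cyl"
  unfolding tangent_def
proof
  fix x assume x: "x \<in> cyl"
  show "\<exists>\<gamma>. \<gamma> 0 = x \<and> (\<forall>s. \<gamma> s \<in> cyl) \<and>
     (\<forall>i. ((\<lambda>s. \<gamma> s i) has_field_derivative T_field i x) (at 0))"
    using x by (intro exI[of _ "\<lambda>s i. x i + s * T_field i x"])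
      (auto simp: cyl_def T_field_def algebra_simps intro!: derivative_eq_intros)
qed

lemma tangent_cyl:
  assumes "\<And>t. tangent v (slice t)" shows "tangent v cyl"
  unfolding tangent_def
proof
  fix x assume "x \<in> cyl"
  then show "\<exists>\<gamma>. \<gamma> 0 = x \<and> (\<forall>s. \<gamma> s \<in> cyl) \<and>
     (\<forall>i. ((\<lambda>s. \<gamma> s i) has_field_derivative v i x) (at 0))"
    using assms[of "x 4", unfolded tangent_def] cyl_in_slice slice_subset_cyl by metis
qed

section \<open>Reduction to monomials in five variables\<close>

abbreviation monomial :: "complex \<Rightarrow> nat \<Rightarrow> nat \<Rightarrow> nat \<Rightarrow> nat \<Rightarrow> nat \<Rightarrow> (nat \<Rightarrow> complex) \<Rightarrow> complex" where
  "monomial c i j k l m \<equiv> \<lambda>x. c * x 0 ^ i * x 1 ^ j * x 2 ^ k * x 3 ^ l * x 4 ^ m"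

inductive_set mono_span :: "((nat \<Rightarrow> complex) \<Rightarrow> complex) set" where
  monomial: "monomial c i j k l m \<in> mono_span"
| add: "p \<in> mono_span \<Longrightarrow> q \<in> mono_span \<Longrightarrow> (\<lambda>x. p x + q x) \<in> mono_span"

lemma monomial_poly_fun [poly_intros]: "monomial c i j k l m \<in> poly_fun"
  by (intro poly_intros)

lemma mono_span_poly_fun: "p \<in> mono_span \<Longrightarrow> p \<in> poly_fun"
  by (induction rule: mono_span.induct) (blast intro: monomial_poly_fun poly_fun.add)+

lemma mono_span_mult:
  assumes "p \<in> mono_span" "q \<in> mono_span"
  shows "(\<lambda>x. p x * q x) \<in> mono_span"
  using assms(1)
proof induction
  case (monomial c i j k l m)
  show ?case using assms(2)
  proof induction
    case (monomial c' i' j' k' l' m')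
    show ?case
      using mono_span.monomial[of "c * c'" "i + i'" "j + j'" "k + k'" "l + l'" "m + m'"]
      by (simp add: power_add mult_ac)
  next
    case (add p q)
    then show ?case by (simp only: distrib_left mono_span.add)
  qed
next
  case (add p q)
  then show ?case by (simp only: distrib_right mono_span.add)
qed

text \<open>Coordinates from 5 on vanish on \<open>cyl\<close>, so only five variables survive
  there. Statements about means then reduce to single monomials, whose means have a closed
  formula.\<close>

lemma poly_fun_eq_mono_span:
  assumes "p \<in> poly_fun"
  shows "\<exists>w\<in>mono_span. \<forall>x\<in>cyl. p x = w x"
  using assms
proof induction
  case (const c)
  then show ?case using mono_span.monomial[of c 0 0 0 0 0] by auto
next
  case (var i)
  consider "i = 0" | "i = 1" | "i = 2" | "i = 3" | "i = 4" | "i \<ge> 5" by linarith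
  then show ?case
  proof cases
    case 1 then show ?thesis using mono_span.monomial[of 1 1 0 0 0 0] by auto
  next
    case 2 then show ?thesis using mono_span.monomial[of 1 0 1 0 0 0] by auto
  next
    case 3 then show ?thesis using mono_span.monomial[of 1 0 0 1 0 0] by auto
  next
    case 4 then show ?thesis using mono_span.monomial[of 1 0 0 0 1 0] by auto
  next
    case 5 then show ?thesis using mono_span.monomial[of 1 0 0 0 0 1] by auto
  next
    case 6 then show ?thesis using mono_span.monomial[of 0 0 0 0 0 0] by (auto simp: cyl_def)
  qed
next
  case (add p q)
  then show ?case by (metis (no_types, lifting) mono_span.add)
next
  case (mult p q)
  then show ?case by (metis (no_types, lifting) mono_span_mult)
qed

section \<open>Means over roots of unity and beta integrals\<close>

definition root_mean :: "nat \<Rightarrow> (complex \<Rightarrow> complex) \<Rightarrow> complex" where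
  "root_mean N f = (\<Sum>p<N. f (cis (2 * pi * real p / real N))) / of_nat N"

lemma root_mean_add: "root_mean N (\<lambda>u. f u + g u) = root_mean N f + root_mean N g"
  by (simp add: root_mean_def sum.distrib add_divide_distrib)

lemma root_mean_cmult: "root_mean N (\<lambda>u. c * f u) = c * root_mean N f"
  by (simp add: root_mean_def sum_distrib_left)

lemma root_mean_cong: "(\<And>u. u \<noteq> 0 \<Longrightarrow> f u = g u) \<Longrightarrow> root_mean N f = root_mean N g"
  by (simp add: root_mean_def)

definition orth :: "nat \<Rightarrow> nat \<Rightarrow> nat \<Rightarrow> complex" where
  "orth N i l = root_mean N (\<lambda>u. u ^ i * (1 / u) ^ l)"

text \<open>For i different from l this is a geometric sum with ratio z = exp(2 pi i (i - l) / N),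
  in which the first i of the exponent is the imaginary unit. The bounds keep |i - l| below N, so z
  is not 1, while z ^ N = 1.\<close>

lemma orth_eq:
  assumes "i < N" "l < N"
  shows "orth N i l = (if i = l then 1 else 0)"
proof (cases "i = l")
  case True
  have "orth N i l = root_mean N (\<lambda>u. 1)"
    unfolding orth_def True by (rule root_mean_cong) (simp add: power_one_over)
  then show ?thesis using assms True by (simp add: root_mean_def)
next
  case False
  define z where "z = cis (2 * pi * (real i - real l) / real N)"
  have "z \<noteq> 1"
  proof
    assume "z = 1"
    then have "cos (2 * pi * (real i - real l) / real N) = 1"
      by (metis z_def cis.sel(1) one_complex.sel(1))
    then obtain k :: int where "2 * pi * (real i - real l) / real N = of_int k * 2 * pi"
      using cos_one_2pi_int by auto
    then have "(2 * pi) * (real i - real l) = (2 * pi) * (of_int k * real N)"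
      using assms by (simp add: divide_eq_eq mult_ac)
    then have "real i - real l = of_int k * real N"
      by (subst (asm) mult_left_cancel) auto
    then have "real_of_int (int i - int l) = real_of_int (k * int N)"
      by simp
    then have k: "int i - int l = k * int N"
      by (simp only: of_int_eq_iff)
    have "k = 0"
    proof (rule ccontr)
      assume "k \<noteq> 0"
      then have "1 * int N \<le> \<bar>k\<bar> * int N" by (intro mult_right_mono) auto
      also have "\<dots> = \<bar>int i - int l\<bar>" by (simp add: k abs_mult)
      also have "\<dots> < int N" using assms by auto
      finally show False by simp
    qed
    then show False using k False by simp
  qed
  have "cis (2 * pi * real p / real N) ^ i * (1 / cis (2 * pi * real p / real N)) ^ l = z ^ p" for p
  proof -
    have "1 / cis (2 * pi * real p / real N) = cis (- (2 * pi * real p / real N))"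
      by (simp only: cis_inverse[symmetric] inverse_eq_divide)
    then show ?thesis
      by (simp only: Complex.DeMoivre cis_mult z_def) (simp add: diff_divide_distrib algebra_simps)
  qed
  then have "orth N i l = (\<Sum>p<N. z ^ p) / of_nat N"
    by (simp add: orth_def root_mean_def)
  moreover have "z ^ N = 1"
  proof -
    have "real N * (2 * pi * (real i - real l) / real N) = 2 * pi * of_int (int i - int l)"
      using assms by simp
    then have "z ^ N = cis (2 * pi * of_int (int i - int l))"
      by (simp only: z_def Complex.DeMoivre)
    then show ?thesis by (simp only: cis_multiple_2pi Ints_of_int)
  qed
  ultimately show ?thesis using \<open>z \<noteq> 1\<close> False by (simp add: sum_gp_strict)
qed

text \<open>The Euler beta value B(i + 1, j + 1), taken in the complex numbers.\<close>

definition beta :: "nat \<Rightarrow> nat \<Rightarrow> complex" where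
  "beta i j = integral {0..1::real} (\<lambda>r. (1 - of_real r) ^ i * of_real r ^ j)"

text \<open>The function (1 - r)^(i + 1) r^(j + 1) vanishes at both ends of [0, 1], so its
  derivative has integral 0.\<close>

lemma beta_shift: "of_nat (Suc j) * beta (Suc i) j = of_nat (Suc i) * beta i (Suc j)"
proof -
  let ?g = "\<lambda>i j (r::real). (1 - complex_of_real r) ^ i * complex_of_real r ^ j"
  let ?d = "\<lambda>r. of_nat (Suc j) * ?g (Suc i) j r - of_nat (Suc i) * ?g i (Suc j) r"
  have *: "((\<lambda>z::complex. (1 - z) ^ Suc i * z ^ Suc j) has_field_derivative
     of_nat (Suc j) * ((1 - z) ^ Suc i * z ^ j) - of_nat (Suc i) * ((1 - z) ^ i * z ^ Suc j)) (at z)" for z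
    by (rule DERIV_cong[OF DERIV_mult[OF DERIV_power[OF DERIV_diff[OF DERIV_const DERIV_ident]]
          DERIV_power[OF DERIV_ident]]])
      (simp only: diff_Suc_Suc diff_zero diff_0 mult_1_left mult_minus_left mult_minus_right uminus_add_conv_diff mult_ac)
  have "(?g (Suc i) (Suc j) has_vector_derivative ?d r) (at r within {0..1})" for r
    by (rule has_vector_derivative_real_field[where f = "\<lambda>z. (1 - z) ^ Suc i * z ^ Suc j", OF *])
  then have "(?d has_integral ?g (Suc i) (Suc j) 1 - ?g (Suc i) (Suc j) 0) {0..1}"
    by (intro fundamental_theorem_of_calculus zero_le_one)
  then have "integral {0..1} ?d = 0" 
    by (subst integral_unique, assumption) simp
  moreover have int: "?g k l integrable_on {0..1}" for k l
    by (intro integrable_continuous_real continuous_intros)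
  have "integral {0..1} ?d = integral {0..1} (\<lambda>r. of_nat (Suc j) * ?g (Suc i) j r) -
     integral {0..1} (\<lambda>r. of_nat (Suc i) * ?g i (Suc j) r)"
    by (intro integral_diff integrable_on_mult_right int)
  then have "integral {0..1} ?d = of_nat (Suc j) * beta (Suc i) j - of_nat (Suc i) * beta i (Suc j)"
    by (simp only: beta_def integral_mult_right)
  ultimately show ?thesis by simp
qed

text \<open>The matrix in SU(2) with first row (sqrt(1 - r) u, sqrt(r) v), where |u| = |v| = 1, has
  the same products \<open>x 0 * x 3\<close> = 1 - r and \<open>x 1 * x 2\<close> = -r. Moving all
  square roots into the first row makes the integrands polynomial in r.\<close>

definition sl2_point :: "complex \<Rightarrow> complex \<Rightarrow> complex \<Rightarrow> complex \<Rightarrow> nat \<Rightarrow> complex" where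
  "sl2_point r u v t i = (if i = 0 then (1 - r) * u else if i = 1 then r * v else
     if i = 2 then - 1 / v else if i = 3 then 1 / u else if i = 4 then t else 0)"

lemma sl2_point_slice: "u \<noteq> 0 \<Longrightarrow> v \<noteq> 0 \<Longrightarrow> sl2_point r u v t \<in> slice t"
  by (auto simp: slice_def sl2_point_def)

text \<open>On polynomials of degree below \<open>N\<close> this is the Haar mean of SU(2): the means over the roots of unity
  \<open>u\<close> and \<open>v\<close> kill all monomials but products of powers of \<open>x 0 * x 3\<close> and \<open>x 1 * x 2\<close>, which are functions
  of a variable \<open>r\<close> that is uniformly distributed on [0, 1] under the Haar measure.\<close>

definition avg :: "nat \<Rightarrow> complex \<Rightarrow> ((nat \<Rightarrow> complex) \<Rightarrow> complex) \<Rightarrow> complex" where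
  "avg N t f = root_mean N (\<lambda>u. root_mean N (\<lambda>v.
     integral {0..1::real} (\<lambda>r. f (sl2_point (of_real r) u v t))))"

lemma avg_cong: "(\<And>x. x \<in> slice t \<Longrightarrow> f x = g x) \<Longrightarrow> avg N t f = avg N t g"
  unfolding avg_def by (intro root_mean_cong) (simp add: sl2_point_slice)

lemma continuous_sl2_point:
  assumes "p \<in> poly_fun"
  shows "continuous_on A (\<lambda>r. p (sl2_point (of_real r) u v t))"
  using assms
proof induction
  case (var i)
  consider "i = 0" | "i = 1" | "i \<ge> 2" by linarith
  then show ?case
    by cases (auto simp: sl2_point_def intro!: continuous_intros)
qed (auto intro!: continuous_intros)

lemma avg_add:
  assumes "p \<in> poly_fun" "q \<in> poly_fun"
  shows "avg N t (\<lambda>x. p x + q x) = avg N t p + avg N t q"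
proof -
  have "integral {0..1::real} (\<lambda>r. p (sl2_point (of_real r) u v t) + q (sl2_point (of_real r) u v t))
     = integral {0..1} (\<lambda>r. p (sl2_point (of_real r) u v t)) +
       integral {0..1} (\<lambda>r. q (sl2_point (of_real r) u v t))" for u v
    by (intro integral_add integrable_continuous_real continuous_sl2_point assms)
  then show ?thesis unfolding avg_def by (simp add: root_mean_add)
qed

lemma avg_monomial:
  "avg N t (monomial c i j k l m) = c * t ^ m * (-1) ^ k * beta i j * orth N i l * orth N j k"
proof -
  have "integral {0..1::real} (\<lambda>r. monomial c i j k l m (sl2_point (of_real r) u v t))
     = (c * t ^ m * (-1) ^ k * beta i j * (u ^ i * (1 / u) ^ l)) * (v ^ j * (1 / v) ^ k)"
    (is "?l = ?r") for u v
  proof -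
    have *: "(- (1 / v)) ^ k = (-1) ^ k * (1 / v) ^ k" by (rule power_minus)
    have "?l = integral {0..1::real} (\<lambda>r. (c * t ^ m * (-1) ^ k * (u ^ i * (1 / u) ^ l) * (v ^ j * (1 / v) ^ k))
       * ((1 - of_real r) ^ i * of_real r ^ j))"
      by (rule integral_cong) (simp add: sl2_point_def power_mult_distrib *)
    also have "\<dots> = ?r"
      by (simp add: beta_def)
    finally show ?thesis .
  qed
  then have "avg N t (monomial c i j k l m) = root_mean N (\<lambda>u. root_mean N (\<lambda>v.
      (c * t ^ m * (-1) ^ k * beta i j * (u ^ i * (1 / u) ^ l)) * (v ^ j * (1 / v) ^ k)))"
    unfolding avg_def by (simp only:)
  also have "\<dots> = root_mean N (\<lambda>u. (c * t ^ m * (-1) ^ k * beta i j * orth N j k) * (u ^ i * (1 / u) ^ l))"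
    by (intro arg_cong[where f = "root_mean N"] ext, unfold root_mean_cmult orth_def) (simp only: mult_ac)
  also have "\<dots> = c * t ^ m * (-1) ^ k * beta i j * orth N i l * orth N j k"
    unfolding root_mean_cmult orth_def by (simp only: mult_ac)
  finally show ?thesis .
qed

section \<open>The mean annihilates derivatives along E, F and H\<close>

lemma lie_monomial:
  "lie v (monomial c i j k l m) x =
     monomial (of_nat i * c) (i - 1) j k l m x * v 0 x + monomial (of_nat j * c) i (j - 1) k l m x * v 1 x +
     monomial (of_nat k * c) i j (k - 1) l m x * v 2 x + monomial (of_nat l * c) i j k (l - 1) m x * v 3 x +
     monomial (of_nat m * c) i j k l (m - 1) x * v 4 x"
  by (simp add: lie_mult lie_power poly_intros algebra_simps)

text \<open>The derivative consists of two monomials. By orthogonality both have mean 0 unless j = k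
  + 1 and l = i + 1; in that case \<open>beta_shift\<close> makes them cancel, the opposite sign
  coming from the extra factor \<open>x 2\<close>. The 1 in the bound on N allows for the exponent
  that E raises.\<close>

lemma avg_lie_E_monomial:
  assumes "N > i + j + k + l + 1"
  shows "avg N t (lie E_field (monomial c i j k l m)) = 0"
proof -
  have "lie E_field (monomial c i j k l m) =
      (\<lambda>x. monomial (of_nat j * c) (Suc i) (j - 1) k l m x + monomial (of_nat l * c) i j (Suc k) (l - 1) m x)"
    by (rule ext, subst lie_monomial) (simp add: E_field_def algebra_simps)
  then have *: "avg N t (lie E_field (monomial c i j k l m)) =
      of_nat j * c * t ^ m * (-1) ^ k * beta (Suc i) (j - 1) * orth N (Suc i) l * orth N (j - 1) k +
      of_nat l * c * t ^ m * (-1) ^ Suc k * beta i j * orth N i (l - 1) * orth N j (Suc k)"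
    by (simp only: avg_add[OF monomial_poly_fun monomial_poly_fun] avg_monomial)
  show ?thesis
  proof (cases "j = Suc k \<and> l = Suc i")
    case True
    then show ?thesis using assms beta_shift[of k i] unfolding * by (simp add: orth_eq)
  next
    case False
    then show ?thesis using assms unfolding * by (cases j; cases l; auto simp: orth_eq)
  qed
qed

lemma avg_lie_F_monomial:
  assumes "N > i + j + k + l + 1"
  shows "avg N t (lie F_field (monomial c i j k l m)) = 0"
proof -
  have "lie F_field (monomial c i j k l m) =
      (\<lambda>x. monomial (of_nat i * c) (i - 1) (Suc j) k l m x + monomial (of_nat k * c) i j (k - 1) (Suc l) m x)"
    by (rule ext, subst lie_monomial) (simp add: F_field_def algebra_simps)
  then have *: "avg N t (lie F_field (monomial c i j k l m)) =
      of_nat i * c * t ^ m * (-1) ^ k * beta (i - 1) (Suc j) * orth N (i - 1) l * orth N (Suc j) k +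
      of_nat k * c * t ^ m * (-1) ^ (k - 1) * beta i j * orth N i (Suc l) * orth N j (k - 1)"
    by (simp only: avg_add[OF monomial_poly_fun monomial_poly_fun] avg_monomial)
  show ?thesis
  proof (cases "k = Suc j \<and> i = Suc l")
    case True
    then show ?thesis using assms beta_shift[of j l] unfolding * by (simp add: orth_eq)
  next
    case False
    then show ?thesis using assms unfolding * by (cases i; cases k; auto simp: orth_eq)
  qed
qed

text \<open>A monomial is an eigenvector of H with weight i - j + k - l. Its mean vanishes unless i
  = l and j = k, and then the weight is 0.\<close>

lemma avg_lie_H_monomial:
  assumes "N > i + j + k + l + 1"
  shows "avg N t (lie H_field (monomial c i j k l m)) = 0"
proof -
  \<comment> \<open>At q = 0 the exponent q - 1 is truncated, but the factor q makes both sides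
    0.\<close>
  have *: "of_nat q * z ^ (q - Suc 0) * z = of_nat q * z ^ q" for q and z :: complex
    by (cases q) auto
  have "lie H_field (monomial c i j k l m) =
      monomial ((of_nat i - of_nat j + of_nat k - of_nat l) * c) i j k l m"
  proof
    fix x :: "nat \<Rightarrow> complex"
    have "lie H_field (monomial c i j k l m) x =
      c * (of_nat i * x 0 ^ (i - Suc 0) * x 0) * x 1 ^ j * x 2 ^ k * x 3 ^ l * x 4 ^ m
      - c * x 0 ^ i * (of_nat j * x 1 ^ (j - Suc 0) * x 1) * x 2 ^ k * x 3 ^ l * x 4 ^ m
      + c * x 0 ^ i * x 1 ^ j * (of_nat k * x 2 ^ (k - Suc 0) * x 2) * x 3 ^ l * x 4 ^ m
      - c * x 0 ^ i * x 1 ^ j * x 2 ^ k * (of_nat l * x 3 ^ (l - Suc 0) * x 3) * x 4 ^ m"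
      by (subst lie_monomial) (simp add: H_field_def algebra_simps)
    then show "lie H_field (monomial c i j k l m) x =
      monomial ((of_nat i - of_nat j + of_nat k - of_nat l) * c) i j k l m x"
      unfolding * by (simp add: algebra_simps)
  qed
  then have "avg N t (lie H_field (monomial c i j k l m)) = (of_nat i - of_nat j + of_nat k - of_nat l) * c
      * t ^ m * (-1) ^ k * beta i j * orth N i l * orth N j k"
    by (simp only: avg_monomial)
  then show ?thesis
    using assms by (simp add: orth_eq)
qed

lemma avg_lie_span:
  assumes "p \<in> mono_span"
  shows "\<forall>\<^sub>F N in sequentially. \<forall>t. avg N t (lie E_field p) = 0 \<and> avg N t (lie F_field p) = 0 \<and>
    avg N t (lie H_field p) = 0"
  using assms
proof induction
  case (monomial c i j k l m)
  show ?case
    by (rule eventually_mono[OF eventually_gt_at_top[of "i + j + k + l + 1"]])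
      (simp only: avg_lie_E_monomial avg_lie_F_monomial avg_lie_H_monomial simp_thms)
next
  case (add p q)
  from add.IH show ?case
    by (rule eventually_elim2)
      (simp add: lie_add avg_add mono_span_poly_fun add.hyps poly_fun_lie poly_fun_fields)
qed

text \<open>This is the infinitesimal right invariance of Haar measure. The bound on N grows with
  the degree of p, hence the filter; the parameter enters the mean of a monomial only as a factor
  \<open>t ^ m\<close>, hence N is uniform in t.\<close>

lemma eventually_avg_lie:
  assumes "p \<in> poly_fun"
  shows "\<forall>\<^sub>F N in sequentially. \<forall>t. avg N t (lie E_field p) = 0 \<and> avg N t (lie F_field p) = 0 \<and>
    avg N t (lie H_field p) = 0"
proof -
  obtain w where w: "w \<in> mono_span" "\<And>x. x \<in> cyl \<Longrightarrow> p x = w x"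
    using poly_fun_eq_mono_span[OF assms] by blast
  have "avg N t (lie v p) = avg N t (lie v w)" if "tangent v (slice t)" for N t v
    by (intro avg_cong lie_cong_on[OF that] assms mono_span_poly_fun w)
      (auto intro: slice_subset_cyl)
  then show ?thesis
    using avg_lie_span[OF w(1)] tangent_E tangent_F tangent_H by simp
qed

text \<open>Differentiation under the mean, without exchanging limits: for monomials the mean is an
  explicit multiple of \<open>t ^ m\<close>.\<close>

lemma avg_has_derivative:
  assumes "p \<in> poly_fun"
  shows "((\<lambda>t. avg N t p) has_field_derivative avg N t (lie T_field p)) (at t)"
proof -
  obtain w where w: "w \<in> mono_span" "\<And>x. x \<in> cyl \<Longrightarrow> p x = w x"
    using poly_fun_eq_mono_span[OF assms] by blast
  have "((\<lambda>t. avg N t w) has_field_derivative avg N t (lie T_field w)) (at t)"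
    using w(1)
  proof induction
    case (monomial c i j k l m)
    have *: "lie T_field (monomial c i j k l m) = monomial (of_nat m * c) i j k l (m - 1)"
      by (rule ext, subst lie_monomial) (simp add: T_field_def)
    show ?case
      unfolding * avg_monomial by (auto intro!: derivative_eq_intros)
  next
    case (add p q)
    then show ?case
      by (simp add: lie_add avg_add mono_span_poly_fun poly_fun_lie poly_fun_fields DERIV_add)
  qed
  moreover have "avg N t p = avg N t w" for t
    by (intro avg_cong w slice_subset_cyl)
  moreover have "avg N t (lie T_field p) = avg N t (lie T_field w)"
    by (intro avg_cong lie_cong_on[OF tangent_T] assms mono_span_poly_fun w)
      (auto intro: slice_subset_cyl)
  ultimately show ?thesis by simp
qed

lemma avg_const: "N > 0 \<Longrightarrow> avg N t (\<lambda>x. c) = c"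
  using avg_monomial[of N t c 0 0 0 0 0] by (simp add: orth_eq beta_def)

section \<open>The trace form of a family of matrices\<close>

text \<open>Functions of two indices inherit pointwise sums and differences without side conditions
  on dimensions; the size n enters only through \<open>mm\<close>, \<open>tr\<close> and
  \<open>idm\<close>.\<close>

type_synonym cmat = "nat \<Rightarrow> nat \<Rightarrow> complex"

definition mm :: "nat \<Rightarrow> cmat \<Rightarrow> cmat \<Rightarrow> cmat" where
  "mm n a b = (\<lambda>i j. \<Sum>k<n. a i k * b k j)"

definition comm :: "nat \<Rightarrow> cmat \<Rightarrow> cmat \<Rightarrow> cmat" where
  "comm n a b = mm n a b - mm n b a"

definition tr :: "nat \<Rightarrow> cmat \<Rightarrow> complex" where
  "tr n a = (\<Sum>i<n. a i i)"

definition idm :: "nat \<Rightarrow> cmat" where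
  "idm n i j = (if i = j \<and> i < n then 1 else 0)"

lemma mm_add_left: "mm n (a + b) c = mm n a c + mm n b c"
  by (simp add: mm_def fun_eq_iff distrib_right sum.distrib)

lemma mm_add_right: "mm n a (b + c) = mm n a b + mm n a c"
  by (simp add: mm_def fun_eq_iff distrib_left sum.distrib)

lemma mm_diff_left: "mm n (a - b) c = mm n a c - mm n b c"
  by (simp add: mm_def fun_eq_iff left_diff_distrib sum_subtractf)

lemma mm_diff_right: "mm n a (b - c) = mm n a b - mm n a c"
  by (simp add: mm_def fun_eq_iff right_diff_distrib sum_subtractf)

lemma mm_uminus_left: "mm n (- a) b = - mm n a b"
  by (simp add: mm_def fun_eq_iff sum_negf)

lemma mm_assoc: "mm n (mm n a b) c = mm n a (mm n b c)"
proof (intro ext)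
  fix i j
  have "mm n (mm n a b) c i j = (\<Sum>k<n. \<Sum>l<n. a i l * b l k * c k j)"
    by (simp add: mm_def sum_distrib_right)
  also have "\<dots> = (\<Sum>l<n. \<Sum>k<n. a i l * b l k * c k j)" by (rule sum.swap)
  also have "\<dots> = mm n a (mm n b c) i j" by (simp add: mm_def sum_distrib_left mult.assoc)
  finally show "mm n (mm n a b) c i j = mm n a (mm n b c) i j" .
qed

lemma mm_idm_left: "(\<And>i j. i \<ge> n \<Longrightarrow> a i j = 0) \<Longrightarrow> mm n (idm n) a = a"
  by (intro ext, rename_tac i j, case_tac "i < n")
    (auto simp: mm_def idm_def if_distrib[of "\<lambda>z. z * _"] sum.delta' not_less cong: if_cong)

lemma mm_idm_right: "(\<And>i j. j \<ge> n \<Longrightarrow> a i j = 0) \<Longrightarrow> mm n a (idm n) = a"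
  by (auto simp: mm_def idm_def fun_eq_iff if_distrib[of "\<lambda>z. _ * z"] sum.delta' not_less cong: if_cong)

lemma tr_add: "tr n (a + b) = tr n a + tr n b"
  by (simp add: tr_def sum.distrib)

lemma tr_diff: "tr n (a - b) = tr n a - tr n b"
  by (simp add: tr_def sum_subtractf)

lemma tr_commute: "tr n (mm n a b) = tr n (mm n b a)"
  unfolding tr_def mm_def by (subst sum.swap) (simp add: mult.commute)

text \<open>Cyclic invariance, oriented so that a marked factor s is rotated to the front. In
  \<open>trace_form_identity\<close> every expanded trace contains exactly one of s, Es, Fs, Hs, so
  this yields a normal form.\<close>

lemma tr_cycle:
  "tr n (mm n a (mm n s b)) = tr n (mm n s (mm n b a))"
  "tr n (mm n a (mm n b s)) = tr n (mm n s (mm n a b))"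
  "tr n (mm n a (mm n b (mm n s c))) = tr n (mm n s (mm n c (mm n a b)))"
  "tr n (mm n a (mm n b (mm n c s))) = tr n (mm n s (mm n a (mm n b c)))"
  by (metis mm_assoc tr_commute)+

text \<open>The equations assumed are the Maurer--Cartan equations for a basis of sl(2) and a commuting
  parameter field; the conclusion says that the derivative of the 3-form
  \<open>tr (a [b, c])\<close> in the parameter is exact.\<close>

lemma trace_form_identity:
  assumes "Ta = Es + comm n a s" "Tb = Fs + comm n b s" "Tc = Hs + comm n c s"
    and "Eb = Fa + comm n b a + c" "Ha = Ec + comm n a c + (a + a)" "Fc = Hb + comm n c b + (b + b)"
  shows "tr n (mm n Ta (comm n b c)) + tr n (mm n a (comm n Tb c + comm n b Tc)) =
      tr n (mm n Es (comm n b c)) + tr n (mm n s (comm n Eb c + comm n b Ec)) +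
      (tr n (mm n Fs (comm n c a)) + tr n (mm n s (comm n Fc a + comm n c Fa))) +
      (tr n (mm n Hs (comm n a b)) + tr n (mm n s (comm n Ha b + comm n a Hb)))"
  \<comment> \<open>On the left the commutators with s cancel by invariance of the trace form. On
    the right Fa, Ec and Hb cancel in pairs, the structure constants by [c, c] = 0 and [a, b] +
    [b, a] = 0, and the triple commutators by the Jacobi identity.\<close>
  unfolding assms comm_def
  by (simp only: mm_add_left mm_add_right mm_diff_left mm_diff_right mm_assoc tr_add tr_diff
      tr_cycle[where s = s] tr_cycle[where s = Es] tr_cycle[where s = Fs] tr_cycle[where s = Hs])
    (simp add: algebra_simps)

section \<open>Derivatives of matrix-valued polynomials\<close>

definition mpoly :: "((nat \<Rightarrow> complex) \<Rightarrow> cmat) \<Rightarrow> bool" where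
  "mpoly A \<longleftrightarrow> (\<forall>i j. (\<lambda>x. A x i j) \<in> poly_fun)"

definition mlie :: "(nat \<Rightarrow> (nat \<Rightarrow> complex) \<Rightarrow> complex) \<Rightarrow> ((nat \<Rightarrow> complex) \<Rightarrow> cmat)
    \<Rightarrow> (nat \<Rightarrow> complex) \<Rightarrow> cmat" where
  "mlie v A x = (\<lambda>i j. lie v (\<lambda>y. A y i j) x)"

lemma mpoly_mm: "mpoly A \<Longrightarrow> mpoly B \<Longrightarrow> mpoly (\<lambda>x. mm n (A x) (B x))"
  by (auto simp: mpoly_def mm_def intro!: poly_intros)

lemma mpoly_diff: "mpoly A \<Longrightarrow> mpoly B \<Longrightarrow> mpoly (\<lambda>x. A x - B x)"
  by (auto simp: mpoly_def intro!: poly_intros)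

lemma mpoly_comm: "mpoly A \<Longrightarrow> mpoly B \<Longrightarrow> mpoly (\<lambda>x. comm n (A x) (B x))"
  unfolding comm_def by (intro mpoly_mm mpoly_diff)

lemma mpoly_mlie: "mpoly A \<Longrightarrow> (\<And>i. v i \<in> poly_fun) \<Longrightarrow> mpoly (mlie v A)"
  by (auto simp: mpoly_def mlie_def intro!: poly_intros)

lemma poly_fun_tr: "mpoly A \<Longrightarrow> (\<lambda>x. tr n (A x)) \<in> poly_fun"
  by (auto simp: mpoly_def tr_def intro!: poly_intros)

lemma mlie_mm:
  assumes "mpoly A" "mpoly B"
  shows "mlie v (\<lambda>x. mm n (A x) (B x)) x = mm n (mlie v A x) (B x) + mm n (A x) (mlie v B x)"
  using assms
  by (simp add: mlie_def mm_def mpoly_def fun_eq_iff lie_sum lie_mult poly_fun.mult sum.distrib)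

lemma mlie_diff:
  "mpoly A \<Longrightarrow> mpoly B \<Longrightarrow> mlie v (\<lambda>x. A x - B x) x = mlie v A x - mlie v B x"
  by (simp add: mlie_def mpoly_def fun_eq_iff lie_diff)

lemma mlie_comm:
  assumes "mpoly A" "mpoly B"
  shows "mlie v (\<lambda>x. comm n (A x) (B x)) x = comm n (mlie v A x) (B x) + comm n (A x) (mlie v B x)"
  unfolding comm_def using assms by (simp add: mlie_diff mlie_mm mpoly_mm)

lemma lie_tr: "mpoly A \<Longrightarrow> lie v (\<lambda>x. tr n (A x)) x = tr n (mlie v A x)"
  by (simp add: mlie_def tr_def mpoly_def lie_sum)

lemma lie_tr_mm_comm:
  assumes "mpoly A" "mpoly B" "mpoly C"
  shows "lie v (\<lambda>x. tr n (mm n (A x) (comm n (B x) (C x)))) x =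
    tr n (mm n (mlie v A x) (comm n (B x) (C x))) +
    tr n (mm n (A x) (comm n (mlie v B x) (C x) + comm n (B x) (mlie v C x)))"
  using assms by (simp add: lie_tr mlie_mm mlie_comm mpoly_mm mpoly_comm tr_add)

lemma mlie_cong_on:
  assumes "tangent v S" "x \<in> S" "mpoly A" "mpoly B" "\<And>y. y \<in> S \<Longrightarrow> A y = B y"
  shows "mlie v A x = mlie v B x"
  unfolding mlie_def using assms by (intro ext lie_cong_on[OF assms(1,2)]) (auto simp: mpoly_def)

lemma mlie_const: "mlie v (\<lambda>x. a) x = 0"
  by (simp add: mlie_def fun_eq_iff)

lemma mlie_bracket:
  assumes "mpoly A" "\<And>i. v i \<in> poly_fun" "\<And>i. w i \<in> poly_fun"
  shows "mlie v (mlie w A) x - mlie w (mlie v A) x = mlie (\<lambda>i x. lie v (w i) x - lie w (v i) x) A x"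
  using assms by (simp add: mlie_def mpoly_def fun_eq_iff lie_bracket)

lemma lie_scale: "p \<in> poly_fun \<Longrightarrow> lie (\<lambda>i x. c * v i x) p x = c * lie v p x"
  by (induction rule: poly_fun.induct) (simp_all add: lie_add lie_mult algebra_simps)

lemma lie_zero_field: "p \<in> poly_fun \<Longrightarrow> lie (\<lambda>i x. 0) p x = 0"
  by (induction rule: poly_fun.induct) (simp_all add: lie_add lie_mult)

lemma mlie_double:
  assumes "mpoly A" shows "mlie (\<lambda>i x. 2 * v i x) A x = mlie v A x + mlie v A x"
  using assms by (simp add: mlie_def mpoly_def fun_eq_iff lie_scale)

text \<open>Left-invariant fields obey the relations of sl(2) with unchanged signs. The order of the
  two fields in this and the next two brackets is the cyclic one of
  \<open>trace_form_identity\<close>.\<close>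

lemma bracket_E_F: "(\<lambda>i x. lie E_field (F_field i) x - lie F_field (E_field i) x) = H_field"
proof (intro ext)
  fix i :: nat and x
  consider "i = 0" | "i = 1" | "i = 2" | "i = 3" | "i > 3" by linarith
  then show "lie E_field (F_field i) x - lie F_field (E_field i) x = H_field i x"
    by cases (simp_all add: E_field_def[abs_def] F_field_def[abs_def] H_field_def)
qed

lemma bracket_H_E: "(\<lambda>i x. lie H_field (E_field i) x - lie E_field (H_field i) x) = (\<lambda>i x. 2 * E_field i x)"
proof (intro ext)
  fix i :: nat and x
  consider "i = 0" | "i = 1" | "i = 2" | "i = 3" | "i > 3" by linarith
  then show "lie H_field (E_field i) x - lie E_field (H_field i) x = 2 * E_field i x"
    by cases (simp_all add: E_field_def[abs_def] H_field_def[abs_def] lie_uminus poly_fun.var)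
qed

lemma bracket_F_H: "(\<lambda>i x. lie F_field (H_field i) x - lie H_field (F_field i) x) = (\<lambda>i x. 2 * F_field i x)"
proof (intro ext)
  fix i :: nat and x
  consider "i = 0" | "i = 1" | "i = 2" | "i = 3" | "i > 3" by linarith
  then show "lie F_field (H_field i) x - lie H_field (F_field i) x = 2 * F_field i x"
    by cases (simp_all add: F_field_def[abs_def] H_field_def[abs_def] lie_uminus poly_fun.var)
qed

lemma bracket_T:
  assumes "v = E_field \<or> v = F_field \<or> v = H_field"
  shows "(\<lambda>i x. lie T_field (v i) x - lie v (T_field i) x) = (\<lambda>i x. 0)"
proof (intro ext)
  fix i :: nat and x
  consider "i = 0" | "i = 1" | "i = 2" | "i = 3" | "i = 4" | "i > 4" by linarith
  then show "lie T_field (v i) x - lie v (T_field i) x = 0"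
    using assms
    by cases (auto simp: E_field_def[abs_def] F_field_def[abs_def] H_field_def[abs_def]
        T_field_def[abs_def] lie_uminus poly_fun.var)
qed

text \<open>M and N are polynomial on the whole space but inverse to each other only on
  \<open>cyl\<close>, so the identities between them may be differentiated only along fields tangent
  to \<open>cyl\<close>.\<close>

locale invertible_family =
  fixes n :: nat and M N :: "(nat \<Rightarrow> complex) \<Rightarrow> cmat"
  assumes mpoly_M: "mpoly M" and mpoly_N: "mpoly N"
    and N_support: "\<And>x i j. i \<ge> n \<or> j \<ge> n \<Longrightarrow> N x i j = 0"
    and NM: "\<And>x. x \<in> cyl \<Longrightarrow> mm n (N x) (M x) = idm n"
    and MN: "\<And>x. x \<in> cyl \<Longrightarrow> mm n (M x) (N x) = idm n"
begin

text \<open>The Maurer--Cartan form g^{-1} dg, pulled back along M and evaluated at v.\<close>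

definition theta :: "(nat \<Rightarrow> (nat \<Rightarrow> complex) \<Rightarrow> complex) \<Rightarrow> (nat \<Rightarrow> complex) \<Rightarrow> cmat" where
  "theta v x = mm n (N x) (mlie v M x)"

lemma mpoly_theta: "(\<And>i. v i \<in> poly_fun) \<Longrightarrow> mpoly (theta v)"
  unfolding theta_def[abs_def] by (intro mpoly_mm mpoly_mlie mpoly_M mpoly_N)

text \<open>Differentiate N M = 1 along w and multiply by N from the right.\<close>

lemma mlie_N:
  assumes "tangent w cyl" "x \<in> cyl"
  shows "mlie w N x = - mm n (theta w x) (N x)"
proof -
  have "mlie w (\<lambda>x. mm n (N x) (M x)) x = mlie w (\<lambda>x. idm n) x"
    using NM by (intro mlie_cong_on[OF assms] mpoly_mm mpoly_N mpoly_M)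
      (auto simp: mpoly_def poly_fun.const)
  then have "mm n (mlie w N x) (M x) = - theta w x"
    by (simp add: mlie_mm mpoly_M mpoly_N mlie_const theta_def eq_neg_iff_add_eq_0)
  then have "mm n (mm n (mlie w N x) (M x)) (N x) = - mm n (theta w x) (N x)"
    by (simp add: mm_uminus_left)
  \<comment> \<open>Right multiplication by \<open>idm n\<close> fixes only matrices whose columns
    from n on vanish.\<close>
  moreover have "mlie w N x i j = 0" if "j \<ge> n" for i j
    using that N_support by (simp add: mlie_def)
  ultimately show ?thesis
    by (simp add: mm_assoc MN assms mm_idm_right)
qed

text \<open>By the product rule and \<open>mlie_N\<close>, w(N v(M)) = N w(v(M)) - theta(w)
  theta(v). Exchanging v and w and subtracting leaves the commutator and, from the second
  derivatives, the bracket of the fields.\<close>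

lemma maurer_cartan:
  assumes "tangent w cyl" "tangent v cyl" "x \<in> cyl" "\<And>i. v i \<in> poly_fun" "\<And>i. w i \<in> poly_fun"
  shows "mlie w (theta v) x = mlie v (theta w) x + comm n (theta v x) (theta w x) +
    theta (\<lambda>i x. lie w (v i) x - lie v (w i) x) x"
proof -
  have *: "mlie w (theta v) x = mm n (N x) (mlie w (mlie v M) x) - mm n (theta w x) (theta v x)"
    if "tangent w cyl" "\<And>i. v i \<in> poly_fun" for v w
  proof -
    have "mlie w (theta v) x = mm n (mlie w N x) (mlie v M x) + mm n (N x) (mlie w (mlie v M) x)"
      unfolding theta_def[abs_def] by (simp add: mlie_mm mpoly_N mpoly_mlie mpoly_M that)
    then show ?thesis
      by (simp add: mlie_N that assms mm_uminus_left mm_assoc flip: theta_def)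
  qed
  have "theta (\<lambda>i x. lie w (v i) x - lie v (w i) x) x =
      mm n (N x) (mlie w (mlie v M) x) - mm n (N x) (mlie v (mlie w M) x)"
    unfolding theta_def by (simp add: mm_diff_right mpoly_M assms flip: mlie_bracket)
  then show ?thesis
    by (simp add: *[OF assms(1,4)] *[OF assms(2,5)] comm_def)
qed

abbreviation "a \<equiv> theta E_field"
abbreviation "b \<equiv> theta F_field"
abbreviation "c \<equiv> theta H_field"
abbreviation "s \<equiv> theta T_field"

definition phi :: "(nat \<Rightarrow> complex) \<Rightarrow> complex" where
  "phi x = tr n (mm n (a x) (comm n (b x) (c x)))"

lemma poly_fun_tr_mm_comm:
  "mpoly A \<Longrightarrow> mpoly B \<Longrightarrow> mpoly C \<Longrightarrow> (\<lambda>x. tr n (mm n (A x) (comm n (B x) (C x)))) \<in> poly_fun"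
  by (intro poly_fun_tr mpoly_mm mpoly_comm)

lemma poly_fun_phi: "phi \<in> poly_fun"
  unfolding phi_def[abs_def] by (intro poly_fun_tr_mm_comm mpoly_theta poly_fun_fields)

lemma theta_zero: "theta (\<lambda>i x. 0) x = 0"
  using mpoly_M by (simp add: theta_def mlie_def mpoly_def lie_zero_field mm_def fun_eq_iff)

lemma theta_double: "theta (\<lambda>i x. 2 * v i x) x = theta v x + theta v x"
  unfolding theta_def by (simp only: mlie_double mpoly_M mm_add_right)

text \<open>Cartan's formula for the Lie derivative of a closed form along T: the traces on the
  right are the components of the contraction of the 3-form with T. Since T commutes with E, F and
  H, its Maurer--Cartan equations have no bracket term.\<close>

lemma lie_T_phi:
  assumes "x \<in> cyl"
  shows "lie T_field phi x =
    lie E_field (\<lambda>x. tr n (mm n (s x) (comm n (b x) (c x)))) x +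
    lie F_field (\<lambda>x. tr n (mm n (s x) (comm n (c x) (a x)))) x +
    lie H_field (\<lambda>x. tr n (mm n (s x) (comm n (a x) (b x)))) x"
proof -
  note MC = maurer_cartan[OF _ _ assms poly_fun_fields(1) poly_fun_fields(4)]
    maurer_cartan[OF _ _ assms poly_fun_fields(2) poly_fun_fields(4)]
    maurer_cartan[OF _ _ assms poly_fun_fields(3) poly_fun_fields(4)]
    maurer_cartan[OF _ _ assms poly_fun_fields(2) poly_fun_fields(1)]
    maurer_cartan[OF _ _ assms poly_fun_fields(1) poly_fun_fields(3)]
    maurer_cartan[OF _ _ assms poly_fun_fields(3) poly_fun_fields(2)]
  note tang = tangent_T tangent_cyl[OF tangent_E] tangent_cyl[OF tangent_F] tangent_cyl[OF tangent_H]
  have T: "mlie T_field a x = mlie E_field s x + comm n (a x) (s x)"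
    "mlie T_field b x = mlie F_field s x + comm n (b x) (s x)"
    "mlie T_field c x = mlie H_field s x + comm n (c x) (s x)"
    using MC(1-3)[OF tang(1)] tang by (simp_all add: bracket_T theta_zero)
  have EFH: "mlie E_field b x = mlie F_field a x + comm n (b x) (a x) + c x"
    "mlie H_field a x = mlie E_field c x + comm n (a x) (c x) + (a x + a x)"
    "mlie F_field c x = mlie H_field b x + comm n (c x) (b x) + (b x + b x)"
    using MC(4)[OF tang(2,3)] MC(5)[OF tang(4,2)] MC(6)[OF tang(3,4)]
    by (simp_all only: bracket_E_F bracket_H_E bracket_F_H theta_double)
  show ?thesis
    unfolding phi_def[abs_def] lie_tr_mm_comm[OF mpoly_theta mpoly_theta mpoly_theta, OF poly_fun_fields(4,1,2)]
    using trace_form_identity[OF T EFH]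
    by (simp only: lie_tr_mm_comm mpoly_theta poly_fun_fields)
qed

text \<open>E is tangent to the slice, so the factor a of the trace already vanishes there.\<close>

lemma phi_eq_0:
  assumes "\<And>x. x \<in> slice 0 \<Longrightarrow> M x = C" "x \<in> slice 0"
  shows "phi x = 0"
proof -
  have "mlie E_field M x = mlie E_field (\<lambda>x. C) x"
    by (intro mlie_cong_on[OF tangent_E assms(2)] mpoly_M assms(1)) (auto simp: mpoly_def poly_fun.const)
  then show ?thesis
    by (simp add: phi_def theta_def mlie_const mm_def tr_def)
qed

end

section \<open>The trace form of the standard inclusion\<close>

definition std :: "nat \<Rightarrow> (nat \<Rightarrow> complex) \<Rightarrow> cmat" where
  "std n x i j = (if i < 2 \<and> j < 2 then x (i * 2 + j) else if i = j \<and> i < n then 1 else 0)"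

lemma mpoly_std: "mpoly (std n)"
  unfolding mpoly_def std_def by (intro allI poly_intros)

definition E_mat :: cmat where "E_mat i j = (if i = 0 \<and> j = 1 then 1 else 0)"
definition F_mat :: cmat where "F_mat i j = (if i = 1 \<and> j = 0 then 1 else 0)"
definition H_mat :: cmat where "H_mat i j = (if i = 0 \<and> j = 0 then 1 else if i = 1 \<and> j = 1 then -1 else 0)"

lemma sum_lessThan_two:
  fixes n :: nat
  assumes "n \<ge> 2" "\<And>k. k \<ge> 2 \<Longrightarrow> f k = 0"
  shows "(\<Sum>k<n. f k) = f 0 + (f 1 :: complex)"
proof -
  have "(\<Sum>k<n. f k) = (\<Sum>k<2. f k)"
    using assms by (intro sum.mono_neutral_right) auto
  then show ?thesis by (simp add: numeral_2_eq_2)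
qed

lemma mm_two:
  assumes "n \<ge> 2" "\<And>k j. k \<ge> 2 \<Longrightarrow> b k j = 0"
  shows "mm n a b = (\<lambda>i j. a i 0 * b 0 j + a i 1 * b 1 j)"
  unfolding mm_def using assms by (intro ext sum_lessThan_two) auto

lemma mlie_std_entry:
  "mlie v (std n) x i j = (if i < 2 \<and> j < 2 then v (i * 2 + j) x else 0)"
  by (auto simp: mlie_def std_def)

lemma nat_cases_2: "i = 0 \<or> i = 1 \<or> i \<ge> (2::nat)"
  by linarith

text \<open>The fields are the derivatives of right multiplication by one-parameter groups, so the
  logarithmic derivatives of the standard inclusion are constant matrices.\<close>

lemma mlie_std:
  assumes "n \<ge> 2"
  shows "mlie E_field (std n) x = mm n (std n x) E_mat"
    and "mlie F_field (std n) x = mm n (std n x) F_mat"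
    and "mlie H_field (std n) x = mm n (std n x) H_mat"
proof -
  have "mlie E_field (std n) x i j = mm n (std n x) E_mat i j \<and>
      mlie F_field (std n) x i j = mm n (std n x) F_mat i j \<and>
      mlie H_field (std n) x i j = mm n (std n x) H_mat i j" for i j
    using nat_cases_2[of i] nat_cases_2[of j] assms
    by (elim disjE) (simp_all add: mlie_std_entry mm_two E_mat_def F_mat_def H_mat_def std_def
      E_field_def F_field_def H_field_def)
  then show "mlie E_field (std n) x = mm n (std n x) E_mat"
    and "mlie F_field (std n) x = mm n (std n x) F_mat"
    and "mlie H_field (std n) x = mm n (std n x) H_mat"
    by (auto simp: fun_eq_iff)
qed

text \<open>[F, H] = 2 F and tr(E F) = 1.\<close>

lemma tr_std:
  assumes "n \<ge> 2"
  shows "tr n (mm n E_mat (comm n F_mat H_mat)) = 2"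
proof -
  have "comm n F_mat H_mat = (\<lambda>i j. if i = 1 \<and> j = 0 then 2 else 0)"
    unfolding comm_def using assms
    by (simp add: mm_two H_mat_def F_mat_def fun_eq_iff)
  then have "mm n E_mat (comm n F_mat H_mat) = (\<lambda>i j. if i = 0 \<and> j = 0 then 2 else 0)"
    using assms by (simp add: mm_two E_mat_def fun_eq_iff)
  then show ?thesis
    using assms by (simp add: tr_def sum_lessThan_two)
qed

context invertible_family
begin

lemma phi_eq_2:
  assumes "n \<ge> 2" "\<And>x. x \<in> slice 1 \<Longrightarrow> M x = std n x" "x \<in> slice 1"
  shows "phi x = 2"
proof -
  have *: "theta v x = A" if "tangent v (slice 1)" "mlie v (std n) x = mm n (std n x) A"
    "\<And>i j. i \<ge> n \<Longrightarrow> A i j = 0" for v A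
  proof -
    have "mlie v M x = mm n (M x) A"
      using mlie_cong_on[OF that(1) assms(3) mpoly_M mpoly_std assms(2)] that(2) assms(2,3) by simp
    then show ?thesis
      using NM[OF slice_subset_cyl[OF assms(3)]] that(3)
      by (simp add: theta_def mm_idm_left flip: mm_assoc)
  qed
  have "a x = E_mat" "b x = F_mat" "c x = H_mat"
    using assms(1)
    by (auto intro!: * tangent_E tangent_F tangent_H mlie_std simp: E_mat_def F_mat_def H_mat_def)
  then show ?thesis
    using tr_std[OF assms(1)] by (simp add: phi_def)
qed

lemma not_std_and_constant:
  assumes "n \<ge> 2" "\<And>x. x \<in> slice 1 \<Longrightarrow> M x = std n x" "\<And>x. x \<in> slice 0 \<Longrightarrow> M x = C"
  shows False
proof -
  define X where "X = (\<lambda>x. tr n (mm n (s x) (comm n (b x) (c x))))"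
  define Y where "Y = (\<lambda>x. tr n (mm n (s x) (comm n (c x) (a x))))"
  define Z where "Z = (\<lambda>x. tr n (mm n (s x) (comm n (a x) (b x))))"
  have poly: "X \<in> poly_fun" "Y \<in> poly_fun" "Z \<in> poly_fun"
    unfolding X_def Y_def Z_def by (intro poly_fun_tr_mm_comm mpoly_theta poly_fun_fields)+
  have "\<forall>\<^sub>F N in sequentially. N > 0 \<and> (\<forall>t. avg N t (lie E_field X) = 0 \<and>
      avg N t (lie F_field Y) = 0 \<and> avg N t (lie H_field Z) = 0)"
    using eventually_gt_at_top[of 0] eventually_avg_lie[OF poly(1)] eventually_avg_lie[OF poly(2)]
      eventually_avg_lie[OF poly(3)]
    by eventually_elim auto
  \<comment> \<open>One N is fixed for all t and all three functions, so that
    \<open>avg N t phi\<close> is a single function of t that can be differentiated.\<close>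
  from eventually_happens'[OF sequentially_bot this]
  obtain N where N: "N > 0" "\<And>t. avg N t (lie E_field X) = 0"
      "\<And>t. avg N t (lie F_field Y) = 0" "\<And>t. avg N t (lie H_field Z) = 0"
    by blast
  have "avg N t (lie T_field phi) = 0" for t
  proof -
    have "avg N t (lie T_field phi) =
        avg N t (\<lambda>x. lie E_field X x + lie F_field Y x + lie H_field Z x)"
      unfolding X_def Y_def Z_def by (intro avg_cong lie_T_phi slice_subset_cyl)
    also have "\<dots> = 0"
      by (simp add: avg_add N poly poly_fun_lie poly_fun_fields poly_fun.add)
    finally show ?thesis .
  qed
  then have "((\<lambda>t. avg N t phi) has_field_derivative 0) (at t)" for t
    using avg_has_derivative[OF poly_fun_phi, of N t] by simp
  then obtain k where "\<And>t. avg N t phi = k"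
    using has_field_derivative_zero_constant[of UNIV "\<lambda>t. avg N t phi"] by auto
  moreover have "avg N 1 phi = 2"
    using avg_cong[of 1 phi "\<lambda>x. 2" N] phi_eq_2[OF assms(1,2)] avg_const[OF N(1)] by simp
  moreover have "avg N 0 phi = 0"
    using avg_cong[of 0 phi "\<lambda>x. 0" N] phi_eq_0[OF assms(3)] avg_const[OF N(1)] by simp
  ultimately show False by simp
qed

end

text \<open>The inverse family is the adjugate: its entries are polynomial in those of m, and it
  inverts the matrix wherever the determinant is 1, in particular on \<open>cyl\<close>.\<close>

lemma SL2_inclusion_not_contractible:
  fixes m :: "nat \<Rightarrow> nat \<Rightarrow> (nat \<Rightarrow> complex) \<Rightarrow> complex"
  assumes "n \<ge> 2" and poly: "\<And>i j. m i j \<in> poly_fun"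
    and det: "\<And>x. x \<in> cyl \<Longrightarrow> det (mat n n (\<lambda>(i, j). m i j x)) = 1"
    and one: "\<And>x i j. x \<in> slice 1 \<Longrightarrow> i < n \<Longrightarrow> j < n \<Longrightarrow> m i j x = std n x i j"
    and zero: "\<And>x i j. x \<in> slice 0 \<Longrightarrow> i < n \<Longrightarrow> j < n \<Longrightarrow> m i j x = C i j"
  shows False
proof -
  define A where "A x = mat n n (\<lambda>(i, j). m i j x)" for x
  define M where "M x i j = (if i < n \<and> j < n then m i j x else 0)" for x i j
  define N where "N x i j = (if i < n \<and> j < n then adj_mat (A x) $$ (i, j) else 0)" for x i j
  have A: "A x \<in> carrier_mat n n" for x by (simp add: A_def)
  have adj: "adj_mat (A x) \<in> carrier_mat n n" for x using adj_mat(1)[OF A] .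
  have "mpoly M"
    unfolding mpoly_def M_def by (intro allI poly_intros poly)
  moreover have "mpoly N"
    unfolding mpoly_def
  proof (intro allI)
    fix i j
    \<comment> \<open>The minor is rewritten as a matrix with polynomial entries, the form that
      \<open>poly_fun_det\<close> requires.\<close>
    have "mat_delete (A x) j i = mat (n - 1) (n - 1) (\<lambda>(i', j').
        m (if i' < j then i' else Suc i') (if j' < i then j' else Suc j') x)"
      if "i < n" "j < n" for x
      unfolding mat_delete_def A_def using that by (auto intro!: eq_matI)
    then have "(\<lambda>x. if i < n \<and> j < n then adj_mat (A x) $$ (i, j) else 0) =
       (\<lambda>x. if i < n \<and> j < n then (-1) ^ (j + i) * det (mat (n - 1) (n - 1) (\<lambda>(i', j').
        m (if i' < j then i' else Suc i') (if j' < i then j' else Suc j') x)) else 0)"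
      using carrier_matD[OF A] by (auto simp: adj_mat_def cofactor_def fun_eq_iff)
    also have "\<dots> \<in> poly_fun"
      by (intro poly_intros poly)
    finally show "(\<lambda>x. N x i j) \<in> poly_fun" unfolding N_def .
  qed
  moreover have entry: "(B * D) $$ (i, j) = (\<Sum>k<n. B $$ (i, k) * D $$ (k, j))"
    if "B \<in> carrier_mat n n" "D \<in> carrier_mat n n" "i < n" "j < n" for B D :: "complex mat" and i j
    using that by (simp add: times_mat_def scalar_prod_def atLeast0LessThan)
  have "mm n (N x) (M x) = idm n \<and> mm n (M x) (N x) = idm n" if "x \<in> cyl" for x
  proof -
    have "adj_mat (A x) * A x = 1\<^sub>m n" "A x * adj_mat (A x) = 1\<^sub>m n"
      using adj_mat(2,3)[OF A, of x] det[OF that] by (auto simp: A_def intro!: eq_matI)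
    then have "mm n (N x) (M x) i j = idm n i j \<and> mm n (M x) (N x) i j = idm n i j" for i j
      using entry[OF adj A, of i j x x] entry[OF A adj, of i j x x]
      by (cases "i < n"; cases "j < n") (auto simp: mm_def N_def M_def idm_def A_def)
    then show ?thesis by (auto simp: fun_eq_iff)
  qed
  ultimately interpret invertible_family n M N
    by unfold_locales (auto simp: N_def)
  show False
  proof (rule not_std_and_constant[of "\<lambda>i j. if i < n \<and> j < n then C i j else 0"])
    show "M x = std n x" if "x \<in> slice 1" for x
      using one[OF that] \<open>n \<ge> 2\<close> by (auto simp: M_def fun_eq_iff std_def)
    show "M x = (\<lambda>i j. if i < n \<and> j < n then C i j else 0)" if "x \<in> slice 0" for x
      using zero[OF that] by (auto simp: M_def fun_eq_iff)
  qed (fact assms)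
qed

section \<open>Embeddings of SL(2)\<close>

lemma det_2:
  assumes "A \<in> carrier_mat 2 2"
  shows "det A = A $$ (0, 0) * A $$ (1, 1) - A $$ (0, 1) * (A $$ (1, 0) :: complex)"
proof -
  have "det A = (\<Sum>j<2. A $$ (0, j) * cofactor A 0 j)"
    by (rule laplace_expansion_row[OF assms]) simp
  moreover have "det (mat_delete A 0 0) = A $$ (1, 1)" "det (mat_delete A 0 1) = A $$ (1, 0)"
    using assms by (subst det_single; simp add: mat_delete_def)+
  ultimately show ?thesis
    by (simp add: numeral_2_eq_2 cofactor_def)
qed

lemma SL_var_2_iff: "x \<in> SL_var 2 \<longleftrightarrow> x 0 * x 3 - x 1 * x 2 = 1 \<and> (\<forall>k\<ge>4. x k = 0)"
proof -
  have "det (mat 2 2 (\<lambda>(i, j). x (i * 2 + j))) = x 0 * x 3 - x 1 * x 2"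
    by (subst det_2) (simp_all add: eval_nat_numeral)
  then show ?thesis by (auto simp: SL_var_def)
qed

lemma affine_variety_SL_var_2: "affine_variety (SL_var 2)"
  unfolding affine_variety_def
proof (intro exI conjI)
  show "{\<lambda>x. x 0 * x 3 - x 1 * x 2 - 1} \<subseteq> poly_fun"
    by (auto intro!: poly_intros)
  show "SL_var 2 = {x. (\<forall>i\<ge>4. x i = 0) \<and> (\<forall>f\<in>{\<lambda>x. x 0 * x 3 - x 1 * x 2 - 1}. f x = 0)}"
    by (auto simp: SL_var_2_iff)
qed

definition flat :: "nat \<Rightarrow> (nat \<Rightarrow> nat \<Rightarrow> complex) \<Rightarrow> nat \<Rightarrow> complex" where
  "flat n A k = (if k < n * n then A (k div n) (k mod n) else 0)"

lemma flat_index: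
  assumes "i < n" "j < n" shows "flat n A (i * n + j) = A i j"
proof -
  have "i * n + j < Suc i * n" using assms by simp
  also have "\<dots> \<le> n * n" using assms by (intro mult_le_mono1) simp
  finally show ?thesis using assms by (simp add: flat_def)
qed

lemma flat_SL_var: "flat n A \<in> SL_var n \<longleftrightarrow> det (mat n n (\<lambda>(i, j). A i j)) = 1"
proof -
  have "mat n n (\<lambda>(i, j). flat n A (i * n + j)) = mat n n (\<lambda>(i, j). A i j)"
    by (intro eq_matI) (auto simp: flat_index)
  then show ?thesis by (simp add: SL_var_def flat_def)
qed

lemma det_std:
  assumes "n \<ge> 2" "x \<in> SL_var 2"
  shows "det (mat n n (\<lambda>(i, j). std n x i j)) = 1"
proof -
  have "mat n n (\<lambda>(i, j). std n x i j) =
    four_block_mat (mat 2 2 (\<lambda>(i, j). x (i * 2 + j))) (0\<^sub>m 2 (n - 2)) (0\<^sub>m (n - 2) 2) (1\<^sub>m (n - 2))"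
    using assms(1) by (intro eq_matI) (auto simp: std_def four_block_mat_def)
  then show ?thesis
    using assms(2) by (simp add: SL_var_def det_four_block_mat_lower_left_zero[where n = 2 and m = "n - 2"])
qed

text \<open>The matrix factors as L U with unipotent triangular factors: L differs from the identity
  only in its first column p, and U only in its first row q.\<close>

lemma det_rank_one_unipotent:
  fixes p q :: "nat \<Rightarrow> complex"
  assumes "p 0 = 1" "q 0 = 1"
  shows "det (mat n n (\<lambda>(i, j). p i * q j + (if i = j \<and> i > 0 then 1 else 0))) = 1"
proof -
  define L where "L = mat n n (\<lambda>(i, j). if j = 0 then p i else if i = j then 1 else 0)"
  define U where "U = mat n n (\<lambda>(i, j). if i = 0 then q j else if i = j then 1 else 0)"
  have carrier: "L \<in> carrier_mat n n" "U \<in> carrier_mat n n" by (simp_all add: L_def U_def)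
  have "det L = prod_list (diag_mat L)"
    by (rule det_lower_triangular[OF _ carrier(1)]) (auto simp: L_def)
  also have "\<dots> = 1"
    unfolding prod_list_diag_prod by (rule prod.neutral) (auto simp: L_def assms)
  finally have L: "det L = 1" .
  have "det U = prod_list (diag_mat U)"
    by (rule det_upper_triangular[OF _ carrier(2)]) (auto simp: U_def)
  also have "\<dots> = 1"
    unfolding prod_list_diag_prod by (rule prod.neutral) (auto simp: U_def assms)
  finally have U: "det U = 1" .
  have "mat n n (\<lambda>(i, j). p i * q j + (if i = j \<and> i > 0 then 1 else 0)) = L * U"
  proof (rule eq_matI)
    fix i j assume "i < dim_row (L * U)" "j < dim_col (L * U)"
    then have ij: "i < n" "j < n" by (simp_all add: L_def U_def)
    then have "(L * U) $$ (i, j) = (\<Sum>k<n. L $$ (i, k) * U $$ (k, j))"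
      by (simp add: L_def U_def scalar_prod_def atLeast0LessThan)
    also have "\<dots> = (\<Sum>k<n. (if k = 0 then p i * q j else 0) + (if k = i then (if i = j \<and> i > 0 then 1 else 0) else 0))"
      using ij by (intro sum.cong) (auto simp: L_def U_def)
    also have "\<dots> = p i * q j + (if i = j \<and> i > 0 then 1 else 0)"
      using ij by (simp add: sum.distrib)
    finally show "mat n n (\<lambda>(i, j). p i * q j + (if i = j \<and> i > 0 then 1 else 0)) $$ (i, j) = (L * U) $$ (i, j)"
      using ij by simp
  qed (simp_all add: L_def U_def)
  then show ?thesis by (simp add: det_mult[OF carrier] L U)
qed

definition std_embedding :: "nat \<Rightarrow> (nat \<Rightarrow> complex) \<Rightarrow> nat \<Rightarrow> complex" where
  "std_embedding n x = flat n (std n x)"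

definition std_retraction :: "nat \<Rightarrow> (nat \<Rightarrow> complex) \<Rightarrow> nat \<Rightarrow> complex" where
  "std_retraction n z k = (if k < 4 then z (k div 2 * n + k mod 2) else 0)"

text \<open>At \<open>t = 1\<close> this embeds SL(2) into the product of two abelian unipotent subgroups, which is
  a closed affine space; scaling the affine space by \<open>t\<close> contracts the embedding.\<close>

definition unip_entry :: "complex \<Rightarrow> (nat \<Rightarrow> complex) \<Rightarrow> nat \<Rightarrow> nat \<Rightarrow> complex" where
  "unip_entry t x i j =
    (if i = 0 then 1 else if i = 1 then t * x 0 else if i = 2 then t * x 1 else 0) *
    (if j = 0 then 1 else if j = 1 then t * x 2 else if j = 2 then t * x 3 else 0) +
    (if i = j \<and> i > 0 then 1 else 0)"

definition unip_embedding :: "nat \<Rightarrow> complex \<Rightarrow> (nat \<Rightarrow> complex) \<Rightarrow> nat \<Rightarrow> complex" where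
  "unip_embedding n t x = flat n (unip_entry t x)"

text \<open>Both vectors in \<open>unip_entry\<close> start with 1, so at t = 1 the first column and
  the first row display the four coordinates themselves. Their indices go up to 2, which is where n
  \<ge> 3 enters.\<close>

definition unip_retraction :: "nat \<Rightarrow> (nat \<Rightarrow> complex) \<Rightarrow> nat \<Rightarrow> complex" where
  "unip_retraction n z k = (if k = 0 then z (1 * n + 0) else if k = 1 then z (2 * n + 0)
     else if k = 2 then z (0 * n + 1) else if k = 3 then z (0 * n + 2) else 0)"

lemma std_embedding_SL_var: "n \<ge> 2 \<Longrightarrow> x \<in> SL_var 2 \<Longrightarrow> std_embedding n x \<in> SL_var n"
  by (simp add: std_embedding_def flat_SL_var det_std)

lemma unip_embedding_SL_var: "unip_embedding n t x \<in> SL_var n"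
  unfolding unip_embedding_def flat_SL_var unip_entry_def by (rule det_rank_one_unipotent) auto

lemma std_retraction_embedding:
  assumes "n \<ge> 2" "x \<in> SL_var 2" shows "std_retraction n (std_embedding n x) = x"
proof
  fix k :: nat
  have "k div 2 < 2" if "k < 4" using that by linarith
  then have "k div 2 < n" "k mod 2 < n" if "k < 4" using that assms(1) by (auto intro: less_le_trans)
  then show "std_retraction n (std_embedding n x) k = x k"
    using assms(2) by (auto simp: std_retraction_def std_embedding_def flat_index std_def SL_var_2_iff)
qed

lemma unip_retraction_embedding:
  assumes "n \<ge> 3" "x \<in> SL_var 2" shows "unip_retraction n (unip_embedding n 1 x) = x"
proof
  fix k :: nat
  have k: "k = 0 \<or> k = 1 \<or> k = 2 \<or> k = 3 \<or> k \<ge> 4" by linarith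
  have "unip_embedding n 1 x (i * n + j) = unip_entry 1 x i j" if "i < 3" "j < 3" for i j
    using that assms(1) by (simp add: unip_embedding_def flat_index)
  note this[of 1 0] this[of 2 0] this[of 0 1] this[of 0 2]
  then show "unip_retraction n (unip_embedding n 1 x) k = x k"
    using k assms(2) by (auto simp: unip_retraction_def unip_entry_def SL_var_2_iff)
qed

lemma poly_fun_std_embedding: "(\<lambda>x. std_embedding n x k) \<in> poly_fun"
  unfolding std_embedding_def flat_def std_def by (intro poly_intros)

lemma poly_fun_std_retraction: "(\<lambda>x. std_retraction n x k) \<in> poly_fun"
  unfolding std_retraction_def by (intro poly_intros)

lemma poly_fun_unip_retraction: "(\<lambda>x. unip_retraction n x k) \<in> poly_fun"
  unfolding unip_retraction_def by (intro poly_intros)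

text \<open>The arguments are general because f will be the homotopy parameter and g the affine
  coordinates of a moved point.\<close>

lemma poly_fun_unip_embedding:
  assumes "\<And>i. (\<lambda>x. g x i) \<in> poly_fun" "f \<in> poly_fun"
  shows "(\<lambda>x. unip_embedding n (f x) (g x) k) \<in> poly_fun"
  unfolding unip_embedding_def flat_def unip_entry_def by (intro poly_intros assms)

section \<open>Morphisms and split closed embeddings\<close>

lemma morphism_poly_fun:
  assumes "\<And>i. (\<lambda>x. f x i) \<in> poly_fun" "\<And>x. x \<in> X \<Longrightarrow> f x \<in> Y"
  shows "morphism X Y f"
  unfolding morphism_def
proof (intro conjI allI)
  show "\<exists>p\<in>poly_fun. \<forall>x\<in>X. f x i = p x" for i
    by (rule bexI[of _ "\<lambda>x. f x i"]) (simp_all add: assms)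
qed (use assms(2) in auto)

lemma morphism_in: "morphism X Y f \<Longrightarrow> x \<in> X \<Longrightarrow> f x \<in> Y"
  by (auto simp: morphism_def)

lemma morphism_compose:
  assumes f: "morphism X Y f" and g: "morphism Y Z g"
  shows "morphism X Z (\<lambda>x. g (f x))"
  unfolding morphism_def
proof (intro conjI allI)
  obtain p where p: "\<And>i. p i \<in> poly_fun" "\<And>i x. x \<in> X \<Longrightarrow> f x i = p i x"
    using f unfolding morphism_def by metis
  fix i
  obtain q where q: "q \<in> poly_fun" "\<And>y. y \<in> Y \<Longrightarrow> g y i = q y"
    using g unfolding morphism_def by metis
  have "g (f x) i = q (\<lambda>i. p i x)" if "x \<in> X" for x
  proof -
    have "f x = (\<lambda>i. p i x)" using p(2)[OF that] by auto
    moreover have "f x \<in> Y" using f that by (auto simp: morphism_def)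
    ultimately show ?thesis using q(2) by metis
  qed
  then show "\<exists>q\<in>poly_fun. \<forall>x\<in>X. g (f x) i = q x"
    by (intro bexI[of _ "\<lambda>x. q (\<lambda>i. p i x)"] ballI poly_fun_compose[OF q(1)] p(1))
next
  show "(\<lambda>x. g (f x)) ` X \<subseteq> Z" using morphism_in[OF g morphism_in[OF f]] by auto
qed

text \<open>Images of morphisms need not be closed, but the retraction r describes this image inside
  X by r x \<in> Y and j (r x) = x. Restricted to the image, r is the inverse of j.\<close>

lemma image_of_split_embedding:
  assumes "affine_variety X" "affine_variety Y"
    and j: "morphism Y X j" and r: "morphism X UNIV r" and rj: "\<And>y. y \<in> Y \<Longrightarrow> r (j y) = y"
  shows "closed_subvariety (j ` Y) X \<and> isomorphic (j ` Y) Y"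
proof
  obtain N F where X: "F \<subseteq> poly_fun" "X = {x. (\<forall>i\<ge>N. x i = 0) \<and> (\<forall>f\<in>F. f x = 0)}"
    using assms(1) unfolding affine_variety_def by blast
  obtain N' F' where Y: "F' \<subseteq> poly_fun" "Y = {x. (\<forall>i\<ge>N'. x i = 0) \<and> (\<forall>f\<in>F'. f x = 0)}"
    using assms(2) unfolding affine_variety_def by blast
  obtain jp where jp: "\<And>i. jp i \<in> poly_fun" "\<And>i y. y \<in> Y \<Longrightarrow> j y i = jp i y"
    using j unfolding morphism_def by metis
  obtain rp where rp: "\<And>i. rp i \<in> poly_fun" "\<And>i x. x \<in> X \<Longrightarrow> r x i = rp i x"
    using r unfolding morphism_def by metis
  \<comment> \<open>The equations of X, the equations of Y pulled back along r together with the
    vanishing of its coordinates from N' on, and j (r x) = x.\<close>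
  define G where "G = F \<union> (\<lambda>f x. f (\<lambda>i. rp i x)) ` F' \<union> rp ` {N'..} \<union>
    range (\<lambda>i x. jp i (\<lambda>k. rp k x) - x i)"
  have "j ` Y = {x. (\<forall>i\<ge>N. x i = 0) \<and> (\<forall>f\<in>G. f x = 0)}"
  proof (intro Set.set_eqI iffI)
    fix x assume "x \<in> j ` Y"
    then obtain y where y: "y \<in> Y" "x = j y" by blast
    then have x: "x \<in> X" using j by (auto simp: morphism_def)
    then have "(\<lambda>i. rp i x) = y" using rp(2)[OF x] rj[OF y(1)] y(2) by auto
    moreover from this have "rp i x = y i" for i by auto
    ultimately show "x \<in> {x. (\<forall>i\<ge>N. x i = 0) \<and> (\<forall>f\<in>G. f x = 0)}"
      using x y jp(2)[OF y(1)] X(2) Y(2) by (auto simp: G_def)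
  next
    fix x assume x: "x \<in> {x. (\<forall>i\<ge>N. x i = 0) \<and> (\<forall>f\<in>G. f x = 0)}"
    then have "x \<in> X" using X(2) by (auto simp: G_def)
    moreover have y: "(\<lambda>i. rp i x) \<in> Y" using x Y(2) by (auto simp: G_def)
    moreover have "j (\<lambda>i. rp i x) = x"
    proof
      fix i
      have "(\<lambda>x. jp i (\<lambda>k. rp k x) - x i) \<in> G" unfolding G_def by blast
      then have "jp i (\<lambda>k. rp k x) - x i = 0" using x by (elim CollectE conjE) (erule bspec)
      then show "j (\<lambda>i. rp i x) i = x i" using jp(2)[OF y] by simp
    qed
    ultimately show "x \<in> j ` Y" by (metis image_eqI)
  qed
  moreover have "G \<subseteq> poly_fun"
  proof -
    have "(\<lambda>x. f (\<lambda>i. rp i x)) \<in> poly_fun" if "f \<in> F'" for f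
      by (rule poly_fun_compose[OF subsetD[OF Y(1) that] rp(1)])
    moreover have "(\<lambda>x. jp i (\<lambda>k. rp k x) - x i) \<in> poly_fun" for i
      by (rule poly_fun_diff[OF poly_fun_compose[OF jp(1) rp(1)] poly_fun.var])
    ultimately show ?thesis
      using X(1) rp(1) unfolding G_def by blast
  qed
  moreover have jX: "j ` Y \<subseteq> X" using j by (auto simp: morphism_def)
  ultimately show "closed_subvariety (j ` Y) X"
    unfolding closed_subvariety_def affine_variety_def by blast
  show "isomorphic (j ` Y) Y"
    unfolding isomorphic_def iso_morphism_def
  proof (intro exI conjI)
    show "morphism (j ` Y) Y r"
      unfolding morphism_def
    proof (intro conjI allI)
      show "\<exists>p\<in>poly_fun. \<forall>x\<in>j ` Y. r x i = p x" for i
        using rp jX by (intro bexI[of _ "rp i"]) auto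
      show "r ` j ` Y \<subseteq> Y" using rj by auto
    qed
    show "morphism Y (j ` Y) j"
      using j by (simp add: morphism_def)
  qed (use rj in auto)
qed

section \<open>Two inequivalent copies of SL(2)\<close>

theorem theorem11p15:
  fixes n :: nat and X :: "(nat \<Rightarrow> complex) set"
  assumes "n \<ge> 3" and "affine_variety X" and "isomorphic X (SL_var n)"
  shows "\<exists>Y1 Y2. closed_subvariety Y1 X \<and> closed_subvariety Y2 X \<and>
           isomorphic Y1 (SL_var 2) \<and> isomorphic Y2 (SL_var 2) \<and>
           \<not> (\<exists>\<alpha>. automorphism X \<alpha> \<and> \<alpha> ` Y1 = Y2)"
proof -
  obtain \<Phi> \<Psi> where \<Phi>: "morphism X (SL_var n) \<Phi>" and \<Psi>: "morphism (SL_var n) X \<Psi>"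
    and \<Psi>\<Phi>: "\<And>x. x \<in> X \<Longrightarrow> \<Psi> (\<Phi> x) = x" and \<Phi>\<Psi>: "\<And>z. z \<in> SL_var n \<Longrightarrow> \<Phi> (\<Psi> z) = z"
    using assms(3) unfolding isomorphic_def iso_morphism_def by blast
  have n: "n \<ge> 2" using assms(1) by simp
  let ?j1 = "\<lambda>x. \<Psi> (std_embedding n x)" and ?j2 = "\<lambda>x. \<Psi> (unip_embedding n 1 x)"
  have e1: "morphism (SL_var 2) (SL_var n) (std_embedding n)"
    by (intro morphism_poly_fun poly_fun_std_embedding std_embedding_SL_var[OF n])
  have e2: "morphism (SL_var 2) (SL_var n) (unip_embedding n 1)"
    by (intro morphism_poly_fun poly_fun_unip_embedding unip_embedding_SL_var poly_fun.var poly_fun.const)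
  have r1: "morphism (SL_var n) UNIV (std_retraction n)"
    by (intro morphism_poly_fun poly_fun_std_retraction UNIV_I)
  have r2: "morphism (SL_var n) UNIV (unip_retraction n)"
    by (intro morphism_poly_fun poly_fun_unip_retraction UNIV_I)
  have Y1: "closed_subvariety (?j1 ` SL_var 2) X \<and> isomorphic (?j1 ` SL_var 2) (SL_var 2)"
    by (rule image_of_split_embedding[OF assms(2) affine_variety_SL_var_2 morphism_compose[OF e1 \<Psi>]
          morphism_compose[OF \<Phi> r1]])
      (simp add: \<Phi>\<Psi> std_embedding_SL_var n std_retraction_embedding)
  have Y2: "closed_subvariety (?j2 ` SL_var 2) X \<and> isomorphic (?j2 ` SL_var 2) (SL_var 2)"
    by (rule image_of_split_embedding[OF assms(2) affine_variety_SL_var_2 morphism_compose[OF e2 \<Psi>]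
          morphism_compose[OF \<Phi> r2]])
      (simp add: \<Phi>\<Psi> unip_embedding_SL_var assms(1) unip_retraction_embedding)
  have False if aut: "automorphism X \<alpha>" and image: "\<alpha> ` ?j1 ` SL_var 2 = ?j2 ` SL_var 2" for \<alpha>
  proof -
    obtain \<beta> where \<alpha>: "morphism X X \<alpha>" and \<beta>: "morphism X X \<beta>" and \<beta>\<alpha>: "\<forall>x\<in>X. \<beta> (\<alpha> x) = x"
      using aut unfolding automorphism_def iso_morphism_def by blast
    \<comment> \<open>Transported to SL(n), \<open>?g\<close> is the inverse automorphism, and
      \<open>?q\<close> gives the affine coordinates of the image under \<alpha> of a point of the
      first copy.\<close>
    let ?g = "\<lambda>z. \<Phi> (\<beta> (\<Psi> z))"
    let ?q = "\<lambda>y. unip_retraction n (\<Phi> (\<alpha> (?j1 y)))"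
    have g: "morphism (SL_var n) (SL_var n) ?g"
      by (intro morphism_compose[OF morphism_compose[OF \<Psi> \<beta>] \<Phi>])
    then obtain gp where gp: "\<And>k. gp k \<in> poly_fun" "\<And>k z. z \<in> SL_var n \<Longrightarrow> ?g z k = gp k z"
      unfolding morphism_def by metis
    have "morphism (SL_var 2) UNIV ?q"
      by (intro morphism_compose[OF morphism_compose[OF morphism_compose[OF morphism_compose[OF e1 \<Psi>] \<alpha>] \<Phi>] r2])
    then obtain qp where qp: "\<And>k. qp k \<in> poly_fun" "\<And>k y. y \<in> SL_var 2 \<Longrightarrow> ?q y k = qp k y"
      unfolding morphism_def by metis
    \<comment> \<open>Points of \<open>cyl\<close> carry the parameter in coordinate 4, where points
      of \<open>SL_var 2\<close> must be 0.\<close>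
    define tail where "tail x k = (if k < 4 then x k else 0)" for x :: "nat \<Rightarrow> complex" and k :: nat
    \<comment> \<open>The moved copy, scaled in the affine space by the parameter
      \<open>x 4\<close>. Then m applies the inverse automorphism through its polynomial
      representatives \<open>gp\<close>.\<close>
    define h where "h x = unip_embedding n (x 4) (\<lambda>l. qp l (tail x))" for x :: "nat \<Rightarrow> complex"
    define m where "m i j x = gp (i * n + j) (h x)" for i j x
    have tail: "tail x \<in> SL_var 2" if "x \<in> cyl" for x
      using that by (simp add: cyl_def SL_var_2_iff tail_def)
    \<comment> \<open>The determinant is 1 for arbitrary affine coordinates, so \<open>gp\<close>
      represents \<open>?g\<close> at h x even for x outside \<open>cyl\<close>.\<close>
    have h: "h x \<in> SL_var n" for x
      unfolding h_def by (rule unip_embedding_SL_var)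
    have m: "m i j x = ?g (h x) (i * n + j)" for i j x
      unfolding m_def by (rule gp(2)[OF h, symmetric])
    show False
    proof (rule SL2_inclusion_not_contractible[OF n, of m])
      show "m i j \<in> poly_fun" for i j
        unfolding m_def h_def
        by (intro poly_fun_compose[OF gp(1), where g = "\<lambda>k x. unip_embedding n (x 4) (\<lambda>l. qp l (tail x)) k"]
            poly_fun_unip_embedding poly_fun_compose[OF qp(1), where g = "\<lambda>k x. tail x k"])
          (auto simp: tail_def intro!: poly_intros)
      show "det (mat n n (\<lambda>(i, j). m i j x)) = 1" if "x \<in> cyl" for x
        using g h[of x] by (auto simp: m morphism_def SL_var_def)
      show "m i j x = std n x i j" if "x \<in> slice 1" "i < n" "j < n" for x i j
      proof -
        \<comment> \<open>At parameter 1 nothing is scaled: the moved point lies in the second copy,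
          \<open>?q\<close> recovers its coordinates z, and \<open>?g\<close> undoes
          \<alpha>.\<close>
        have tx: "tail x \<in> SL_var 2" using tail slice_subset_cyl that(1) by blast
        then have "\<alpha> (?j1 (tail x)) \<in> ?j2 ` SL_var 2" using image by blast
        then obtain z where z: "z \<in> SL_var 2" "\<alpha> (?j1 (tail x)) = \<Psi> (unip_embedding n 1 z)" by blast
        then have "?q (tail x) = z"
          using unip_retraction_embedding[OF assms(1) z(1)] \<Phi>\<Psi>[OF unip_embedding_SL_var] by simp
        then have "h x = unip_embedding n 1 z"
          using that(1) qp(2)[OF tx, symmetric] by (simp add: h_def slice_def)
        then have "?g (h x) = \<Phi> (\<beta> (\<alpha> (?j1 (tail x))))" using z(2) by simp
        also have "\<dots> = std_embedding n (tail x)"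
          using morphism_in[OF e1 tx] morphism_in[OF \<Psi>] by (simp add: \<beta>\<alpha> \<Phi>\<Psi>)
        finally have "m i j x = std n (tail x) i j"
          using that by (simp add: m std_embedding_def flat_index)
        then show ?thesis by (auto simp: std_def tail_def)
      qed
      show "m i j x = ?g (unip_embedding n 0 (\<lambda>_. 0)) (i * n + j)" if "x \<in> slice 0" for x i j
      proof -
        have "unip_entry 0 y = unip_entry 0 (\<lambda>_. 0)" for y
          by (simp add: unip_entry_def fun_eq_iff)
        then have "h x = unip_embedding n 0 (\<lambda>_. 0)"
          using that unfolding h_def unip_embedding_def slice_def by (metis (mono_tags) mem_Collect_eq)
        then show ?thesis by (simp add: m)
      qed
    qed
  qed
  then show ?thesis using Y1 Y2 by blast
qed

end
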